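(* Let $(\mathcal W,\mathcal S)$ be an extended Coxeter system of star type with $|\mathcal S|=n+1$, with set of reflections $\mathcal T=\bigcup_{w\in\mathcal W}w\mathcal Sw^{-1}$, and let $c$ be a Coxeter transformation. Then the Hurwitz action of the braid group $\mathcal B_{n+1}$ is transitive on $\mathrm{Red}_{\mathcal T}(c)=\{(t_1,\ldots,t_{n+1})\in\mathcal T^{n+1}\mid c=t_1\cdots t_{n+1}\}$.
   Context: A star is a tree with at most one vertex of degree larger than $2$. Let $(\overline W,\overline S)$ be a (simply laced) Coxeter system of rank $n$ whose Coxeter diagram $\overline\Gamma$ is a star, $\overline S=\{s_1,\ldots,s_n\}$, where $1$ labels a vertex of maximal degree in $\overline\Gamma$ (if $\overline\Gamma$ is a path, i.e. of type $A_n$, any vertex may be chosen as $1$). Let $\overline V$ be its geometric representation with basis of simple roots $\alpha_1,\ldots,\alpha_n$ and symmetric form with $\langle\alpha_i\mid\alpha_i\rangle=2$, $\langle\alpha_i\mid\alpha_j\rangle=-1$ if $i,j$ are adjacent and $0$ otherwise; let $\overline\Phi=\overline W\{\alpha_1,\ldots,\alpha_n\}$ be the root system and $L(\overline\Phi)=\mathrm{span}_{\mathbb Z}(\overline\Phi)$ the root lattice. The extended Coxeter group is $\mathcal W=\overline W\ltimes L(\overline\Phi)$, whose elements are pairs $(\overline w,\lambda)$ with multiplication $(\overline w_1,\lambda_1)(\overline w_2,\lambda_2)=(\overline w_1\overline w_2,\overline w_2^{-1}(\lambda_1)+\lambda_2)$. Identify $s_i$ with $(s_i,0)$, put $s_{1^*}=(s_1,\alpha_1)$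 and $\mathcal S=\overline S\cup\{s_{1^*}\}$. Then $(\mathcal W,\mathcal S)$ is an extended Coxeter system of star type. A Coxeter transformation is $c=c_0s_1s_{1^*}$, where $c_0$ is the product of the elements of $\overline S\setminus\{s_1\}$ in some order. Hurwitz action: $\mathcal B_m$ with standard generators $\sigma_i$ acts on $\mathcal T^m$ by $\sigma_i(g_1,\ldots,g_m)=(g_1,\ldots,g_{i-1},g_{i+1},g_{i+1}^{-1}g_ig_{i+1},g_{i+2},\ldots,g_m)$. *)

theory Defs
  imports "HOL-Analysis.Analysis" "HOL-Algebra.Group_Action"
begin

section \<open>Groups given by generators and relators\<close>

text \<open>A word is a list of signed letters; \<open>(x, True)\<close> stands for the generator \<open>x\<close> and
  \<open>(x, False)\<close> for its formal inverse.\<close>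

definition words :: "'a set \<Rightarrow> ('a \<times> bool) list set" where
  "words X = lists (X \<times> UNIV)"

inductive reduces ::
  "'a set \<Rightarrow> ('a \<times> bool) list set \<Rightarrow> ('a \<times> bool) list \<Rightarrow> ('a \<times> bool) list \<Rightarrow> bool"
  for X R where
  cancel: "x \<in> X \<Longrightarrow> reduces X R (u @ [(x, b), (x, \<not> b)] @ v) (u @ v)"
| relator: "r \<in> R \<Longrightarrow> reduces X R (u @ r @ v) (u @ v)"

definition word_rel ::
  "'a set \<Rightarrow> ('a \<times> bool) list set \<Rightarrow> (('a \<times> bool) list \<times> ('a \<times> bool) list) set" where
  "word_rel X R = {(u, v). u \<in> words X \<and> v \<in> words X \<and> equivclp (reduces X R) u v}"

definition presented_group ::
  "'a set \<Rightarrow> ('a \<times> bool) list set \<Rightarrow> ('a \<times> bool) list set monoid" where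
  "presented_group X R =
    \<lparr>carrier = words X // word_rel X R,
     mult = (\<lambda>A B. \<Union>u\<in>A. \<Union>v\<in>B. word_rel X R `` {u @ v}),
     one = word_rel X R `` {[]}\<rparr>"


section \<open>Coxeter systems\<close>

text \<open>The entry \<open>0\<close> of a Coxeter matrix encodes \<open>\<infinity>\<close>, that is, the absence of a relation.\<close>

definition coxeter_matrix :: "('i \<Rightarrow> 'i \<Rightarrow> nat) \<Rightarrow> bool" where
  "coxeter_matrix M \<longleftrightarrow> (\<forall>i j. M i j = M j i) \<and> (\<forall>i j. M i j = 1 \<longleftrightarrow> i = j)"

definition coxeter_relators :: "('i \<Rightarrow> 'i \<Rightarrow> nat) \<Rightarrow> ('i \<times> bool) list set" where
  "coxeter_relators M =
    {concat (replicate (M i j) [(i, True), (j, True)]) | i j. M i j \<noteq> 0}"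

definition coxeter_system ::
  "('w, 'b) monoid_scheme \<Rightarrow> ('i \<Rightarrow> 'w) \<Rightarrow> ('i \<Rightarrow> 'i \<Rightarrow> nat) \<Rightarrow> bool" where
  "coxeter_system W s M \<longleftrightarrow> group W \<and> coxeter_matrix M \<and>
    (\<exists>h \<in> iso (presented_group UNIV (coxeter_relators M)) W.
      \<forall>i. h (word_rel UNIV (coxeter_relators M) `` {[(i, True)]}) = s i)"

text \<open>The Coxeter matrix of the simply laced Coxeter system whose diagram is the simple graph \<open>E\<close>.\<close>

definition simply_laced_matrix :: "('i \<Rightarrow> 'i \<Rightarrow> bool) \<Rightarrow> 'i \<Rightarrow> 'i \<Rightarrow> nat" where
  "simply_laced_matrix E i j = (if i = j then 1 else if E i j then 3 else 2)"


section \<open>Stars\<close>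

definition simple_graph :: "('n \<Rightarrow> 'n \<Rightarrow> bool) \<Rightarrow> bool" where
  "simple_graph E \<longleftrightarrow> symp E \<and> irreflp E"

definition is_cycle :: "('n \<Rightarrow> 'n \<Rightarrow> bool) \<Rightarrow> 'n list \<Rightarrow> bool" where
  "is_cycle E p \<longleftrightarrow> length p \<ge> 3 \<and> distinct p \<and> successively E p \<and> E (last p) (hd p)"

definition tree_graph :: "('n \<Rightarrow> 'n \<Rightarrow> bool) \<Rightarrow> bool" where
  "tree_graph E \<longleftrightarrow> simple_graph E \<and> (\<forall>i j. E\<^sup>*\<^sup>* i j) \<and> (\<nexists>p. is_cycle E p)"

definition vertex_degree :: "('n::finite \<Rightarrow> 'n \<Rightarrow> bool) \<Rightarrow> 'n \<Rightarrow> nat" where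
  "vertex_degree E i = card {j. E i j}"

definition star_graph :: "('n::finite \<Rightarrow> 'n \<Rightarrow> bool) \<Rightarrow> bool" where
  "star_graph E \<longleftrightarrow> tree_graph E \<and> card {i. vertex_degree E i > 2} \<le> 1"

definition path_graph :: "('n::finite \<Rightarrow> 'n \<Rightarrow> bool) \<Rightarrow> bool" where
  "path_graph E \<longleftrightarrow> tree_graph E \<and> (\<forall>i. vertex_degree E i \<le> 2)"

definition admissible_centre :: "('n::finite \<Rightarrow> 'n \<Rightarrow> bool) \<Rightarrow> 'n \<Rightarrow> bool" where
  "admissible_centre E z \<longleftrightarrow> path_graph E \<or> (\<forall>i. vertex_degree E i \<le> vertex_degree E z)"


section \<open>Geometric representation, root system and root lattice\<close>

definition simple_root :: "'n::finite \<Rightarrow> real ^ 'n" where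
  "simple_root i = axis i 1"

definition root_form :: "('n::finite \<Rightarrow> 'n \<Rightarrow> bool) \<Rightarrow> real ^ 'n \<Rightarrow> real ^ 'n \<Rightarrow> real" where
  "root_form E u v =
    (\<Sum>i\<in>UNIV. \<Sum>j\<in>UNIV. u $ i * v $ j * (if i = j then 2 else if E i j then - 1 else 0))"

definition simple_reflection ::
  "('n::finite \<Rightarrow> 'n \<Rightarrow> bool) \<Rightarrow> 'n \<Rightarrow> real ^ 'n \<Rightarrow> real ^ 'n" where
  "simple_reflection E i v = v - root_form E (simple_root i) v *\<^sub>R simple_root i"

definition group_prod :: "('g, 'b) monoid_scheme \<Rightarrow> 'g list \<Rightarrow> 'g" where
  "group_prod G gs = foldr (mult G) gs (one G)"

text \<open>The element \<open>w\<close> is written as a product of generators \<open>s i\<close>, and acts as the corresponding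
  product of simple reflections. For a simply laced Coxeter system with diagram \<open>E\<close> the simple
  reflections satisfy the Coxeter relations, so the chosen expression is irrelevant.\<close>

definition geometric_rep ::
  "('w, 'b) monoid_scheme \<Rightarrow> ('n::finite \<Rightarrow> 'w) \<Rightarrow> ('n \<Rightarrow> 'n \<Rightarrow> bool) \<Rightarrow>
    'w \<Rightarrow> real ^ 'n \<Rightarrow> real ^ 'n" where
  "geometric_rep W s E w = foldr (simple_reflection E) (SOME u. group_prod W (map s u) = w)"

definition root_system ::
  "('w, 'b) monoid_scheme \<Rightarrow> ('n::finite \<Rightarrow> 'w) \<Rightarrow> ('n \<Rightarrow> 'n \<Rightarrow> bool) \<Rightarrow> (real ^ 'n) set" where
  "root_system W s E = {geometric_rep W s E w (simple_root i) | w i. w \<in> carrier W}"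

definition root_lattice ::
  "('w, 'b) monoid_scheme \<Rightarrow> ('n::finite \<Rightarrow> 'w) \<Rightarrow> ('n \<Rightarrow> 'n \<Rightarrow> bool) \<Rightarrow> (real ^ 'n) set" where
  "root_lattice W s E = module.span (\<lambda>(k::int) v. of_int k *\<^sub>R v) (root_system W s E)"


section \<open>The extended Coxeter group\<close>

definition extended_group ::
  "('w, 'b) monoid_scheme \<Rightarrow> ('n::finite \<Rightarrow> 'w) \<Rightarrow> ('n \<Rightarrow> 'n \<Rightarrow> bool) \<Rightarrow> ('w \<times> (real ^ 'n)) monoid" where
  "extended_group W s E =
    \<lparr>carrier = carrier W \<times> root_lattice W s E,
     mult = (\<lambda>(w1, l1) (w2, l2).
       (w1 \<otimes>\<^bsub>W\<^esub> w2, geometric_rep W s E (inv\<^bsub>W\<^esub> w2) l1 + l2)),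
     one = (\<one>\<^bsub>W\<^esub>, 0)\<rparr>"

definition extended_gen :: "('n::finite \<Rightarrow> 'w) \<Rightarrow> 'n \<Rightarrow> 'w \<times> (real ^ 'n)" where
  "extended_gen s i = (s i, 0)"

definition extra_gen :: "('n::finite \<Rightarrow> 'w) \<Rightarrow> 'n \<Rightarrow> 'w \<times> (real ^ 'n)" where
  "extra_gen s z = (s z, simple_root z)"

definition extended_gens :: "('n::finite \<Rightarrow> 'w) \<Rightarrow> 'n \<Rightarrow> ('w \<times> (real ^ 'n)) set" where
  "extended_gens s z = insert (extra_gen s z) (range (extended_gen s))"

definition reflections ::
  "('w, 'b) monoid_scheme \<Rightarrow> ('n::finite \<Rightarrow> 'w) \<Rightarrow> ('n \<Rightarrow> 'n \<Rightarrow> bool) \<Rightarrow> 'n \<Rightarrow> ('w \<times> (real ^ 'n)) set" where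
  "reflections W s E z = (let G = extended_group W s E in
    {g \<otimes>\<^bsub>G\<^esub> x \<otimes>\<^bsub>G\<^esub> inv\<^bsub>G\<^esub> g | g x. g \<in> carrier G \<and> x \<in> extended_gens s z})"

definition coxeter_transformation ::
  "('w, 'b) monoid_scheme \<Rightarrow> ('n::finite \<Rightarrow> 'w) \<Rightarrow> ('n \<Rightarrow> 'n \<Rightarrow> bool) \<Rightarrow> 'n \<Rightarrow> 'w \<times> (real ^ 'n) \<Rightarrow> bool" where
  "coxeter_transformation W s E z c \<longleftrightarrow> (let G = extended_group W s E in
    \<exists>us. distinct us \<and> set us = UNIV - {z} \<and>
      c = group_prod G (map (extended_gen s) us) \<otimes>\<^bsub>G\<^esub> extended_gen s z \<otimes>\<^bsub>G\<^esub> extra_gen s z)"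


section \<open>Braid groups, factorizations and the Hurwitz action\<close>

definition factorizations :: "('g, 'b) monoid_scheme \<Rightarrow> 'g set \<Rightarrow> nat \<Rightarrow> 'g \<Rightarrow> 'g list set" where
  "factorizations G T m c = {ts. length ts = m \<and> set ts \<subseteq> T \<and> group_prod G ts = c}"

definition red_factorizations ::
  "('w, 'b) monoid_scheme \<Rightarrow> ('n::finite \<Rightarrow> 'w) \<Rightarrow> ('n \<Rightarrow> 'n \<Rightarrow> bool) \<Rightarrow> 'n \<Rightarrow> 'w \<times> (real ^ 'n) \<Rightarrow>
    ('w \<times> (real ^ 'n)) list set" where
  "red_factorizations W s E z c =
    factorizations (extended_group W s E) (reflections W s E z) (CARD('n) + 1) c"

text \<open>The standard generators of the braid group on \<open>m\<close> strands are indexed by \<open>1, \<dots>, m - 1\<close>.\<close>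

definition braid_relators :: "nat \<Rightarrow> (nat \<times> bool) list set" where
  "braid_relators m =
    {[(i, True), (i + 1, True), (i, True), (i + 1, False), (i, False), (i + 1, False)] | i.
        1 \<le> i \<and> i + 1 < m} \<union>
    {[(i, True), (j, True), (i, False), (j, False)] | i j. 1 \<le> i \<and> i + 1 < j \<and> j < m}"

definition braid_group :: "nat \<Rightarrow> (nat \<times> bool) list set monoid" where
  "braid_group m = presented_group {1..<m} (braid_relators m)"

text \<open>Lists are indexed from \<open>0\<close>, so the \<open>i\<close>-th entry of the tuple \<open>ts\<close> is \<open>ts ! (i - 1)\<close>.\<close>

fun hurwitz_letter :: "('g, 'b) monoid_scheme \<Rightarrow> nat \<times> bool \<Rightarrow> 'g list \<Rightarrow> 'g list" where
  "hurwitz_letter G (i, True) ts =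
    ts[i - 1 := ts ! i, i := inv\<^bsub>G\<^esub> (ts ! i) \<otimes>\<^bsub>G\<^esub> ts ! (i - 1) \<otimes>\<^bsub>G\<^esub> ts ! i]"
| "hurwitz_letter G (i, False) ts =
    ts[i - 1 := ts ! (i - 1) \<otimes>\<^bsub>G\<^esub> ts ! i \<otimes>\<^bsub>G\<^esub> inv\<^bsub>G\<^esub> (ts ! (i - 1)), i := ts ! (i - 1)]"

text \<open>A braid, being a class of words, acts on the set \<open>X\<close> of tuples through any of its words.\<close>

definition hurwitz_action ::
  "('g, 'b) monoid_scheme \<Rightarrow> 'g list set \<Rightarrow> (nat \<times> bool) list set \<Rightarrow> 'g list \<Rightarrow> 'g list" where
  "hurwitz_action G X b = (\<lambda>ts\<in>X. foldr (hurwitz_letter G) (SOME u. u \<in> b) ts)"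

end

theory Submission
  imports Defs
begin

text \<open>Sending \<open>(w, l)\<close> to the geometric action of \<open>w\<close> turns a reflection factorization of \<open>c\<close> into a
  factorization of \<open>c\<^sub>0\<close> with \<open>n + 1\<close> factors, and Hurwitz moves lift back along this homomorphism. The
  partial products of such a factorization form a path in the Coxeter group. If the path has a peak
  with two distinct factors, one Hurwitz move lowers the peak; if the factors agree, the pair can be
  moved to the end. What remains is an ascending path, which the exchange condition identifies with
  the simple reflections in \<open>c\<^sub>0\<close>, followed by one pair \<open>(r, r)\<close>, where \<open>r\<close> is the reflection in a root \<open>b\<close>.

  Comparing translation parts shows that \<open>b\<close> has coefficient \<open>1\<close> at the root \<open>\<alpha> z\<close>. Such roots are all
  conjugate to \<open>\<alpha> z\<close> under the reflections in \<open>c\<^sub>0\<close>, and Hurwitz moves conjugate the pair by these. The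
  translation parts are then determined by \<open>c\<close> up to a common shift in the last two factors, which
  is again a Hurwitz move.\<close>

section \<open>Groups given by generators and relators\<close>

text \<open>The last two factors of \<open>c\<close> have the same linear part and cancel in the
  image, so a factorization of \<open>c\<close> has two factors more than the word for
  \<open>c\<^sub>0\<close>. The image alone cannot pin it down, since any pair (r, r) may be
  appended to a factorization of \<open>c\<^sub>0\<close>. The translation supplies the missing
  constraint. Let (w, l) act by x -> w (x + l); the pair then becomes two reflections in parallel
  hyperplanes and composes to a translation by an integer multiple of b. The reflections in
  \<open>c\<^sub>0\<close> never touch the coordinate at z, whereas \<open>c\<close> raises it by 1,
  so that integer times the coefficient of b is 1 and both are units. The Coxeter group may be
  infinite and the form indefinite, so word length and the signs of roots have to do the untangling:
  the sum of the lengths of the partial products drops with each lowered peak. Two roots that both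
  give a descent at a peak may span an infinite rank two system; there the finiteness of the
  inversion set yields the shorter partial product.\<close>

lemma words_simps [simp]:
  "[] \<in> words X" "p # u \<in> words X \<longleftrightarrow> fst p \<in> X \<and> u \<in> words X"
  "u @ v \<in> words X \<longleftrightarrow> u \<in> words X \<and> v \<in> words X"
  by (auto simp: words_def lists_eq_set mem_Times_iff)

lemma reduces_append:
  assumes "reduces X R u v"
  shows "reduces X R (p @ u @ q) (p @ v @ q)"
  using assms
proof cases
  case (cancel x a b c)
  then show ?thesis using reduces.cancel[of x X R "p @ a" b "c @ q"] by simp
next
  case (relator r a c)
  then show ?thesis using reduces.relator[of r R X "p @ a" "c @ q"] by simp
qed

lemma equivclp_reduces_append:
  assumes "equivclp (reduces X R) u v"
  shows "equivclp (reduces X R) (p @ u @ q) (p @ v @ q)"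
  using assms
proof (induction rule: equivclp_induct)
  case base
  then show ?case by simp
next
  case (step y z)
  then have "reduces X R (p @ y @ q) (p @ z @ q) \<or> reduces X R (p @ z @ q) (p @ y @ q)"
    using reduces_append by blast
  then have "equivclp (reduces X R) (p @ y @ q) (p @ z @ q)"
    by (auto intro: r_into_equivclp converse_r_into_equivclp)
  with step.IH show ?case by (meson equivclp_trans)
qed

lemma equiv_word_rel: "equiv (words X) (word_rel X R)"
proof (rule equivI)
  show "sym (word_rel X R)"
    by (rule symI) (simp add: word_rel_def equivclp_sym)
  show "trans (word_rel X R)"
    using equivclp_trans[of "reduces X R"] unfolding word_rel_def by (intro transI) blast
qed (auto simp: word_rel_def refl_on_def)

lemma word_rel_append:
  assumes "(u, u') \<in> word_rel X R" "(v, v') \<in> word_rel X R"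
  shows "(u @ v, u' @ v') \<in> word_rel X R"
proof -
  have "equivclp (reduces X R) (u @ v) (u' @ v)"
    using equivclp_reduces_append[of X R u u' "[]" v] assms by (simp add: word_rel_def)
  moreover have "equivclp (reduces X R) (u' @ v) (u' @ v')"
    using equivclp_reduces_append[of X R v v' u' "[]"] assms by (simp add: word_rel_def)
  ultimately have "equivclp (reduces X R) (u @ v) (u' @ v')"
    by (rule equivclp_trans)
  then show ?thesis
    using assms by (simp add: word_rel_def)
qed

abbreviation word_class :: "'a set \<Rightarrow> ('a \<times> bool) list set \<Rightarrow> ('a \<times> bool) list \<Rightarrow> ('a \<times> bool) list set"
  where "word_class X R u \<equiv> word_rel X R `` {u}"

lemma word_class_eq_iff:
  "\<lbrakk>u \<in> words X; v \<in> words X\<rbrakk> \<Longrightarrow> word_class X R u = word_class X R v \<longleftrightarrow> (u, v) \<in> word_rel X R"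
  using eq_equiv_class_iff[OF equiv_word_rel] by fast

lemma word_class_self: "u \<in> words X \<Longrightarrow> u \<in> word_class X R u"
  using equiv_class_self[OF equiv_word_rel] by fast

lemma presented_group_carrierE:
  assumes "A \<in> carrier (presented_group X R)"
  obtains u where "u \<in> words X" "A = word_class X R u"
  using assms by (auto simp: presented_group_def elim!: quotientE)

lemma word_class_carrier: "u \<in> words X \<Longrightarrow> word_class X R u \<in> carrier (presented_group X R)"
  by (auto simp: presented_group_def intro!: quotientI)

lemma presented_group_mult:
  assumes "u \<in> words X" "v \<in> words X"
  shows "word_class X R u \<otimes>\<^bsub>presented_group X R\<^esub> word_class X R v = word_class X R (u @ v)"
proof -
  have "word_class X R (a @ b) = word_class X R (u @ v)"
    if "a \<in> word_class X R u" "b \<in> word_class X R v" for a b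
    using that by (intro equiv_class_eq[OF equiv_word_rel, symmetric] word_rel_append) auto
  then have "(\<Union>a\<in>word_class X R u. \<Union>b\<in>word_class X R v. word_class X R (a @ b)) = word_class X R (u @ v)"
    using word_class_self[OF assms(1), of R] word_class_self[OF assms(2), of R] by blast
  then show ?thesis
    by (simp add: presented_group_def)
qed

lemma presented_group_one: "\<one>\<^bsub>presented_group X R\<^esub> = word_class X R []"
  by (simp add: presented_group_def)

definition inverse_word :: "('a \<times> bool) list \<Rightarrow> ('a \<times> bool) list" where
  "inverse_word u = rev (map (\<lambda>(x, b). (x, \<not> b)) u)"

lemma inverse_word_in_words: "u \<in> words X \<Longrightarrow> inverse_word u \<in> words X"
  by (induction u) (auto simp: inverse_word_def)

lemma inverse_word_cancel:
  assumes "u \<in> words X"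
  shows "(inverse_word u @ u, []) \<in> word_rel X R"
  using assms
proof (induction u)
  case Nil
  then show ?case by (simp add: inverse_word_def word_rel_def)
next
  case (Cons p u)
  obtain x b where p: "p = (x, b)" by fastforce
  have "reduces X R (inverse_word u @ [(x, \<not> b), (x, \<not> \<not> b)] @ u) (inverse_word u @ u)"
    using Cons.prems p by (intro reduces.cancel) auto
  then have "equivclp (reduces X R) (inverse_word (p # u) @ p # u) (inverse_word u @ u)"
    using p by (auto simp: inverse_word_def)
  then have "equivclp (reduces X R) (inverse_word (p # u) @ p # u) []"
    by (rule equivclp_trans) (use Cons in \<open>simp add: word_rel_def\<close>)
  with Cons.prems show ?case
    using inverse_word_in_words[of "p # u" X] by (simp add: word_rel_def)
qed

lemma group_presented_group: "group (presented_group X R)" (is "group ?P")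
proof (rule groupI)
  fix A B assume "A \<in> carrier ?P" "B \<in> carrier ?P"
  then show "A \<otimes>\<^bsub>?P\<^esub> B \<in> carrier ?P"
    by (elim presented_group_carrierE) (simp add: presented_group_mult word_class_carrier)
next
  show "\<one>\<^bsub>?P\<^esub> \<in> carrier ?P"
    by (simp add: presented_group_one word_class_carrier)
next
  fix A B C assume "A \<in> carrier ?P" "B \<in> carrier ?P" "C \<in> carrier ?P"
  then show "A \<otimes>\<^bsub>?P\<^esub> B \<otimes>\<^bsub>?P\<^esub> C = A \<otimes>\<^bsub>?P\<^esub> (B \<otimes>\<^bsub>?P\<^esub> C)"
    by (elim presented_group_carrierE) (simp add: presented_group_mult)
next
  fix A assume "A \<in> carrier ?P"
  then show "\<one>\<^bsub>?P\<^esub> \<otimes>\<^bsub>?P\<^esub> A = A"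
    by (elim presented_group_carrierE) (simp add: presented_group_mult presented_group_one)
next
  fix A assume "A \<in> carrier ?P"
  then obtain u where u: "u \<in> words X" "A = word_class X R u"
    by (elim presented_group_carrierE)
  then have "word_class X R (inverse_word u @ u) = word_class X R []"
    by (intro equiv_class_eq[OF equiv_word_rel] inverse_word_cancel)
  then have "word_class X R (inverse_word u) \<otimes>\<^bsub>?P\<^esub> A = \<one>\<^bsub>?P\<^esub>"
    using u inverse_word_in_words[of u X] by (simp add: presented_group_mult presented_group_one)
  then show "\<exists>B\<in>carrier ?P. B \<otimes>\<^bsub>?P\<^esub> A = \<one>\<^bsub>?P\<^esub>"
    using word_class_carrier[OF inverse_word_in_words[OF u(1)]] by blast
qed

text \<open>Serves both presentations: braid words acting on factorizations and Coxeter words acting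
  on vectors. The set \<open>Y\<close> is there because Hurwitz letters cancel only on tuples of
  group elements of the right length.\<close>

lemma foldr_word_rel_invariant:
  fixes act :: "'a \<times> bool \<Rightarrow> 'c \<Rightarrow> 'c"
  assumes closed: "\<And>x b p. \<lbrakk>x \<in> X; p \<in> Y\<rbrakk> \<Longrightarrow> act (x, b) p \<in> Y"
    and cancel: "\<And>x b p. \<lbrakk>x \<in> X; p \<in> Y\<rbrakk> \<Longrightarrow> act (x, b) (act (x, \<not> b) p) = p"
    and relator: "\<And>r p. \<lbrakk>r \<in> R; p \<in> Y\<rbrakk> \<Longrightarrow> foldr act r p = p"
    and R: "R \<subseteq> words X"
    and uv: "(u, v) \<in> word_rel X R" and p: "p \<in> Y"
  shows "foldr act u p = foldr act v p"
proof -
  have foldr_closed: "foldr act w q \<in> Y" if "w \<in> words X" "q \<in> Y" for w q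
    using that by (induction w) (auto simp: closed)
  \<comment> \<open>Membership in \<open>words X\<close> is carried as an equivalence because
    \<open>equivclp\<close> may also traverse a reduction backwards.\<close>
  have step: "(a \<in> words X \<longleftrightarrow> b \<in> words X) \<and> (a \<in> words X \<longrightarrow> foldr act a p = foldr act b p)"
    if "reduces X R a b" for a b
    using that
  proof cases
    case (cancel x a' b' c')
    then show ?thesis using assms(2)[of x "foldr act c' p" b'] p foldr_closed by auto
  next
    case (relator r a' c')
    then show ?thesis using assms(3)[of r "foldr act c' p"] R p foldr_closed by auto
  qed
  have "equivclp (reduces X R) u v" "u \<in> words X"
    using uv by (auto simp: word_rel_def)
  then have "v \<in> words X \<and> foldr act u p = foldr act v p"
    by (induction rule: equivclp_induct) (use step in metis)+
  then show ?thesis by blast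
qed


section \<open>The Hurwitz action\<close>

lemma group_prod_simps [simp]:
  "group_prod G [] = \<one>\<^bsub>G\<^esub>" "group_prod G (x # xs) = x \<otimes>\<^bsub>G\<^esub> group_prod G xs"
  by (auto simp: group_prod_def)

lemma (in monoid) group_prod_closed [simp]: "set xs \<subseteq> carrier G \<Longrightarrow> group_prod G xs \<in> carrier G"
  by (induction xs) auto

lemma (in monoid) group_prod_append:
  "\<lbrakk>set xs \<subseteq> carrier G; set ys \<subseteq> carrier G\<rbrakk> \<Longrightarrow>
    group_prod G (xs @ ys) = group_prod G xs \<otimes> group_prod G ys"
  by (induction xs) (auto simp: m_assoc)

lemma factorizations_length: "ts \<in> factorizations G T m c \<Longrightarrow> length ts = m"
  by (simp add: factorizations_def)

lemma length_hurwitz_letter [simp]: "length (hurwitz_letter G p ts) = length ts"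
  by (cases p; cases "snd p") auto

lemma length_foldr_hurwitz_letter [simp]: "length (foldr (hurwitz_letter G) u ts) = length ts"
  by (induction u) auto

lemma split_list_at:
  assumes "0 < i" "i < length ts"
  obtains xs f g ys where "ts = xs @ f # g # ys" "i = Suc (length xs)"
proof
  show "ts = take (i - 1) ts @ ts ! (i - 1) # ts ! i # drop (Suc i) ts"
    using assms by (metis One_nat_def Suc_pred append_take_drop_id Cons_nth_drop_Suc Suc_lessD)
qed (use assms in auto)

lemma hurwitz_letter_append:
  "hurwitz_letter G (Suc (length xs), True) (xs @ f # g # ys) = xs @ g # (inv\<^bsub>G\<^esub> g \<otimes>\<^bsub>G\<^esub> f \<otimes>\<^bsub>G\<^esub> g) # ys"
  "hurwitz_letter G (Suc (length xs), False) (xs @ f # g # ys) = xs @ (f \<otimes>\<^bsub>G\<^esub> g \<otimes>\<^bsub>G\<^esub> inv\<^bsub>G\<^esub> f) # f # ys"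
  by (simp_all add: nth_append list_update_append)

lemma hurwitz_letter_append_right:
  assumes "0 < i" "i < length ts"
  shows "hurwitz_letter G (i, b) (ts @ zs) = hurwitz_letter G (i, b) ts @ zs"
  using assms by (cases b) (auto simp: nth_append list_update_append)

text \<open>Instantiated twice, with the reflections of the extended group and with those of its
  linear image, so that moves can be made in the image and lifted.\<close>

locale conjugation_closed = group +
  fixes T
  assumes T_carrier: "T \<subseteq> carrier G"
    and conj_closed: "\<And>g t. \<lbrakk>g \<in> carrier G; t \<in> T\<rbrakk> \<Longrightarrow> g \<otimes> t \<otimes> inv g \<in> T"
begin

lemma mult_inv_cancel:
  assumes "x \<in> carrier G" "y \<in> carrier G"
  shows "x \<otimes> (inv x \<otimes> y) = y" "inv x \<otimes> (x \<otimes> y) = y"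
  using assms m_assoc[of x "inv x" y] m_assoc[of "inv x" x y] by simp_all

lemma conj_closed_inv: "\<lbrakk>g \<in> carrier G; t \<in> T\<rbrakk> \<Longrightarrow> inv g \<otimes> t \<otimes> g \<in> T"
  using conj_closed[of "inv g" t] by simp

abbreviation letter :: "nat \<times> bool \<Rightarrow> 'a list \<Rightarrow> 'a list" where
  "letter \<equiv> hurwitz_letter G"

lemma letter_in_factorizations:
  assumes i: "i \<in> {1..<m}" and ts: "ts \<in> factorizations G T m c"
  shows "letter (i, b) ts \<in> factorizations G T m c"
proof -
  obtain xs f g ys where eq: "ts = xs @ f # g # ys" "i = Suc (length xs)"
    using split_list_at[of i ts thesis] i factorizations_length[OF ts] by simp
  have sub: "f \<in> T" "g \<in> T" "set xs \<subseteq> T" "set ys \<subseteq> T"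
    using ts eq by (auto simp: factorizations_def)
  then have car: "f \<in> carrier G" "g \<in> carrier G" "set xs \<subseteq> carrier G" "set ys \<subseteq> carrier G"
    using T_carrier by auto
  have 1: "g \<otimes> (inv g \<otimes> f \<otimes> g \<otimes> h) = f \<otimes> (g \<otimes> h)" if "h \<in> carrier G" for h
    using car that by (simp add: m_assoc mult_inv_cancel)
  have 2: "f \<otimes> g \<otimes> inv f \<otimes> (f \<otimes> h) = f \<otimes> (g \<otimes> h)" if "h \<in> carrier G" for h
    using car that by (simp add: m_assoc mult_inv_cancel)
  show ?thesis
    using ts sub car eq(1) conj_closed[of f g] conj_closed_inv[of g f] unfolding eq(2)
    by (cases b; simp only: eq hurwitz_letter_append)
      (auto simp: factorizations_def group_prod_append 1 2)
qed

lemma letter_cancel: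
  assumes i: "i \<in> {1..<m}" and ts: "ts \<in> factorizations G T m c"
  shows "letter (i, b) (letter (i, \<not> b) ts) = ts"
proof -
  obtain xs f g ys where eq: "ts = xs @ f # g # ys" "i = Suc (length xs)"
    using split_list_at[of i ts thesis] i factorizations_length[OF ts] by simp
  have car: "f \<in> carrier G" "g \<in> carrier G"
    using ts eq T_carrier by (auto simp: factorizations_def)
  have "inv f \<otimes> (f \<otimes> g \<otimes> inv f) \<otimes> f = g" "g \<otimes> (inv g \<otimes> f \<otimes> g) \<otimes> inv g = f"
    using car by (simp_all add: m_assoc mult_inv_cancel)
  then show ?thesis
    unfolding eq by (cases b) (simp_all only: hurwitz_letter_append not_True_eq_False not_False_eq_True)
qed

lemma word_in_factorizations:
  assumes "u \<in> words {1..<m}" "ts \<in> factorizations G T m c"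
  shows "foldr letter u ts \<in> factorizations G T m c"
  using assms
proof (induction u)
  case (Cons p u)
  then show ?case using letter_in_factorizations[of "fst p" m _ c "snd p"] by simp
qed simp

text \<open>Both sides turn neighbours f, g, h into h, g conjugated by h, and f conjugated by g and
  then by h.\<close>

lemma letter_braid:
  assumes i: "1 \<le> i" "i + 1 < m" and ts: "ts \<in> factorizations G T m c"
  shows "letter (i, True) (letter (i + 1, True) (letter (i, True) ts)) =
    letter (i + 1, True) (letter (i, True) (letter (i + 1, True) ts))"
proof -
  obtain xs f g' ys' where eq0: "ts = xs @ f # g' # ys'" "i = Suc (length xs)"
    using split_list_at[of i ts thesis] i factorizations_length[OF ts] by simp
  then obtain h ys where eq: "ts = xs @ f # g' # h # ys"
    using i ts by (cases ys') (auto simp: factorizations_def)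
  have car: "f \<in> carrier G" "g' \<in> carrier G" "h \<in> carrier G"
    using ts eq T_carrier by (auto simp: factorizations_def)
  have l: "Suc (length xs) + 1 = Suc (length (xs @ [a]))" for a by simp
  have r: "xs @ a # b # d # ys = (xs @ [a]) @ b # d # ys" for a b d by simp
  have "inv (inv h \<otimes> g' \<otimes> h) \<otimes> (inv h \<otimes> f \<otimes> h) \<otimes> (inv h \<otimes> g' \<otimes> h)
      = inv h \<otimes> (inv g' \<otimes> f \<otimes> g') \<otimes> h"
    using car by (simp add: m_assoc inv_mult_group mult_inv_cancel)
  moreover have "letter (i, True) (xs @ a # b # d # ys) = xs @ b # (inv b \<otimes> a \<otimes> b) # d # ys" for a b d
    unfolding eq0 by (rule hurwitz_letter_append)
  moreover have "letter (i + 1, True) (xs @ a # b # d # ys) = xs @ a # d # (inv d \<otimes> b \<otimes> d) # ys" for a b d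
    unfolding eq0 using hurwitz_letter_append(1)[of G "xs @ [a]" b d ys] by simp
  ultimately show ?thesis by (simp only: eq)
qed

lemma letter_commute:
  assumes "1 \<le> i" "i + 1 < j" "j < length ts"
  shows "letter (i, True) (letter (j, True) ts) = letter (j, True) (letter (i, True) ts)"
proof -
  have "i - 1 \<noteq> j" "i - 1 \<noteq> j - 1" "i \<noteq> j" "i \<noteq> j - 1" "i < length ts"
    using assms by auto
  then show ?thesis
    using assms by (intro nth_equalityI) (simp_all add: nth_list_update)
qed

lemma relators_act_trivially:
  assumes r: "r \<in> braid_relators m" and ts: "ts \<in> factorizations G T m c"
  shows "foldr letter r ts = ts"
proof -
  let ?F = "factorizations G T m c"
  have c: "letter (i, True) (letter (i, False) us) = us" "letter (i, False) (letter (i, True) us) = us"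
    if "i \<in> {1..<m}" "us \<in> ?F" for i us
    using letter_cancel[OF that, of True] letter_cancel[OF that, of False] by auto
  note mem = letter_in_factorizations[of _ m _ c]
  from r consider (braid) i where "1 \<le> i" "i + 1 < m"
      "r = [(i, True), (i + 1, True), (i, True), (i + 1, False), (i, False), (i + 1, False)]"
    | (comm) i j where "1 \<le> i" "i + 1 < j" "j < m" "r = [(i, True), (j, True), (i, False), (j, False)]"
    unfolding braid_relators_def by blast
  then show ?thesis
  proof cases
    case braid
    \<comment> \<open>\<open>foldr\<close> applies the last letter first, so \<open>us\<close> is
      the tuple after the inverse half of the relator. The braid relation at \<open>us\<close> turns
      the remaining half into letters that undo this half one by one.\<close>
    define us where "us = letter (i + 1, False) (letter (i, False) (letter (i + 1, False) ts))"
    have ij: "i \<in> {1..<m}" "i + 1 \<in> {1..<m}" using braid by auto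
    have us: "us \<in> ?F" unfolding us_def by (intro mem ij ts)
    have "foldr letter r ts = letter (i + 1, True) (letter (i, True) (letter (i + 1, True) us))"
      using letter_braid[OF braid(1,2) us] braid(3) by (simp add: us_def del: hurwitz_letter.simps)
    also have "\<dots> = ts"
      unfolding us_def by (simp only: c mem ij ts)
    finally show ?thesis .
  next
    case comm
    define us where "us = letter (i, False) (letter (j, False) ts)"
    have ij: "i \<in> {1..<m}" "j \<in> {1..<m}" using comm by auto
    have us: "us \<in> ?F" unfolding us_def by (intro mem ij ts)
    have "foldr letter r ts = letter (j, True) (letter (i, True) us)"
      using letter_commute[OF comm(1,2), of us] comm us by (simp add: us_def factorizations_def del: hurwitz_letter.simps)
    also have "\<dots> = ts"
      unfolding us_def by (simp only: c mem ij ts)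
    finally show ?thesis .
  qed
qed

lemma hurwitz_action_word_class:
  assumes "u \<in> words {1..<m}" "ts \<in> factorizations G T m c"
  shows "hurwitz_action G (factorizations G T m c) (word_class {1..<m} (braid_relators m) u) ts
    = foldr letter u ts"
proof -
  let ?A = "word_class {1..<m} (braid_relators m) u"
  have "(SOME v. v \<in> ?A) \<in> ?A"
    using word_class_self[OF assms(1)] by (rule someI)
  then have "(u, SOME v. v \<in> ?A) \<in> word_rel {1..<m} (braid_relators m)" by simp
  then have "foldr letter u ts = foldr letter (SOME v. v \<in> ?A) ts"
  proof (rule foldr_word_rel_invariant[rotated 4])
    show "ts \<in> factorizations G T m c" by fact
    show "braid_relators m \<subseteq> words {1..<m}" by (auto simp: braid_relators_def)
  qed (use letter_in_factorizations letter_cancel relators_act_trivially in auto)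
  then show ?thesis using assms(2) by (simp add: hurwitz_action_def)
qed

lemma hurwitz_group_action:
  "group_action (braid_group m) (factorizations G T m c) (hurwitz_action G (factorizations G T m c))"
proof -
  let ?F = "factorizations G T m c" and ?P = "braid_group m"
  let ?cl = "word_class {1..<m} (braid_relators m)" and ?h = "hurwitz_action G (factorizations G T m c)"
  interpret P: group ?P unfolding braid_group_def by (rule group_presented_group)
  have cl: "\<exists>u. u \<in> words {1..<m} \<and> A = ?cl u" if "A \<in> carrier ?P" for A
    using that unfolding braid_group_def by (metis presented_group_carrierE)
  have closed: "?h A ts \<in> ?F" if "A \<in> carrier ?P" "ts \<in> ?F" for A ts
    using cl[OF that(1)] that(2) hurwitz_action_word_class word_in_factorizations by metis
  have mult: "?h (A \<otimes>\<^bsub>?P\<^esub> B) ts = ?h A (?h B ts)" if AB: "A \<in> carrier ?P" "B \<in> carrier ?P" and ts: "ts \<in> ?F" for A B ts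
  proof -
    obtain u v where "u \<in> words {1..<m}" "A = ?cl u" "v \<in> words {1..<m}" "B = ?cl v"
      using cl AB by metis
    then show ?thesis
      using ts by (simp add: braid_group_def presented_group_mult hurwitz_action_word_class
          word_in_factorizations del: One_nat_def)
  qed
  have one: "?h \<one>\<^bsub>?P\<^esub> ts = ts" if "ts \<in> ?F" for ts
    using that hurwitz_action_word_class[of "[]" m] by (simp add: braid_group_def presented_group_one)
  have bij: "?h A \<in> Bij ?F" if A: "A \<in> carrier ?P" for A
  proof -
    have "bij_betw (?h A) ?F ?F"
    proof (rule bij_betwI[where g = "?h (inv\<^bsub>?P\<^esub> A)"])
      fix ts assume "ts \<in> ?F"
      then show "?h (inv\<^bsub>?P\<^esub> A) (?h A ts) = ts" "?h A (?h (inv\<^bsub>?P\<^esub> A) ts) = ts"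
        using A by (simp_all add: one flip: mult)
    qed (use A closed in auto)
    then show ?thesis by (auto simp: Bij_def hurwitz_action_def)
  qed
  have "?h \<in> hom ?P (BijGroup ?F)"
  proof (rule homI)
    fix A B assume AB: "A \<in> carrier ?P" "B \<in> carrier ?P"
    have "?h (A \<otimes>\<^bsub>?P\<^esub> B) = compose ?F (?h A) (?h B)"
    proof
      fix ts
      show "?h (A \<otimes>\<^bsub>?P\<^esub> B) ts = compose ?F (?h A) (?h B) ts"
        using mult[OF AB, of ts] by (cases "ts \<in> ?F") (auto simp: compose_def hurwitz_action_def)
    qed
    then show "?h (A \<otimes>\<^bsub>?P\<^esub> B) = ?h A \<otimes>\<^bsub>BijGroup ?F\<^esub> ?h B"
      using AB bij by (simp add: BijGroup_def)
  qed (use bij in \<open>simp add: BijGroup_def\<close>)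
  then show ?thesis
    by (simp add: group_action_def group_hom_def group_hom_axioms_def group_BijGroup P.group_axioms)
qed

end

text \<open>A word in the letters is asked for, not a braid: the relation then mentions neither a
  set of reflections nor a product, and passes to longer tuples and along homomorphisms.\<close>

definition hurwitz_equiv :: "('g, 'b) monoid_scheme \<Rightarrow> 'g list \<Rightarrow> 'g list \<Rightarrow> bool" where
  "hurwitz_equiv G ts us \<longleftrightarrow> (\<exists>u \<in> words {1..<length ts}. foldr (hurwitz_letter G) u ts = us)"

lemma hurwitz_equiv_refl: "hurwitz_equiv G ts ts"
  unfolding hurwitz_equiv_def by (rule bexI[of _ "[]"]) auto

lemma hurwitz_equiv_trans [trans]:
  assumes "hurwitz_equiv G ts us" "hurwitz_equiv G us vs"
  shows "hurwitz_equiv G ts vs"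
proof -
  obtain u v where "u \<in> words {1..<length ts}" "foldr (hurwitz_letter G) u ts = us"
    "v \<in> words {1..<length us}" "foldr (hurwitz_letter G) v us = vs"
    using assms by (auto simp: hurwitz_equiv_def)
  then show ?thesis
    unfolding hurwitz_equiv_def by (intro bexI[of _ "v @ u"]) auto
qed

lemma hurwitz_equiv_length: "hurwitz_equiv G ts us \<Longrightarrow> length us = length ts"
  by (auto simp: hurwitz_equiv_def)

lemma hurwitz_equiv_right:
  "hurwitz_equiv G (xs @ f # g # ys) (xs @ g # (inv\<^bsub>G\<^esub> g \<otimes>\<^bsub>G\<^esub> f \<otimes>\<^bsub>G\<^esub> g) # ys)"
  unfolding hurwitz_equiv_def
  by (rule bexI[of _ "[(Suc (length xs), True)]"]) (simp_all only: foldr.simps o_apply id_apply hurwitz_letter_append, simp)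

lemma hurwitz_equiv_left:
  "hurwitz_equiv G (xs @ f # g # ys) (xs @ (f \<otimes>\<^bsub>G\<^esub> g \<otimes>\<^bsub>G\<^esub> inv\<^bsub>G\<^esub> f) # f # ys)"
  unfolding hurwitz_equiv_def
  by (rule bexI[of _ "[(Suc (length xs), False)]"]) (simp_all only: foldr.simps o_apply id_apply hurwitz_letter_append, simp)

lemma hurwitz_equiv_append:
  assumes "hurwitz_equiv G ts us"
  shows "hurwitz_equiv G (ts @ zs) (us @ zs)"
proof -
  obtain u where u: "u \<in> words {1..<length ts}" "foldr (hurwitz_letter G) u ts = us"
    using assms by (auto simp: hurwitz_equiv_def)
  have "foldr (hurwitz_letter G) u (ts @ zs) = foldr (hurwitz_letter G) u ts @ zs"
    using u(1)
  proof (induction u)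
    case (Cons p u)
    then show ?case
      using hurwitz_letter_append_right[of "fst p" "foldr (hurwitz_letter G) u ts" G "snd p" zs] by simp
  qed simp
  moreover have "u \<in> words {1..<length (ts @ zs)}"
    using u(1) by (induction u) auto
  ultimately show ?thesis using u(2) by (auto simp: hurwitz_equiv_def)
qed

section \<open>Transitivity criterion and lifting along homomorphisms\<close>

lemma (in conjugation_closed) hurwitz_equiv_factorizations:
  "\<lbrakk>hurwitz_equiv G ts us; ts \<in> factorizations G T m c\<rbrakk> \<Longrightarrow> us \<in> factorizations G T m c"
  using word_in_factorizations factorizations_length by (fastforce simp: hurwitz_equiv_def)

text \<open>One common target suffices: a braid from x to \<open>us\<close> followed by the inverse
  of a braid from y to \<open>us\<close> leads from x to y.\<close>

lemma (in conjugation_closed) hurwitz_transitive_action: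
  assumes "\<And>ts. ts \<in> factorizations G T m c \<Longrightarrow> hurwitz_equiv G ts us"
  shows "transitive_action (braid_group m) (factorizations G T m c) (hurwitz_action G (factorizations G T m c))"
proof -
  let ?F = "factorizations G T m c" and ?h = "hurwitz_action G (factorizations G T m c)"
  interpret group_action "braid_group m" ?F ?h by (rule hurwitz_group_action)
  interpret P: group "braid_group m" unfolding braid_group_def by (rule group_presented_group)
  have "\<exists>b\<in>carrier (braid_group m). ?h b ts = us" if ts: "ts \<in> ?F" for ts
  proof -
    obtain u where "u \<in> words {1..<m}" "foldr letter u ts = us"
      using assms[OF ts] ts by (auto simp: hurwitz_equiv_def factorizations_def)
    then show ?thesis
      using hurwitz_action_word_class[of u m ts c] ts word_class_carrier[of u "{1..<m}"]
      unfolding braid_group_def by blast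
  qed
  then have "\<exists>b\<in>carrier (braid_group m). ?h b x = y" if "x \<in> ?F" "y \<in> ?F" for x y
    using that orbit_sym_aux[of _ y us] composition_rule[of x]
    by (metis P.inv_closed P.m_closed)
  then show ?thesis by unfold_locales auto
qed

text \<open>A Hurwitz letter uses only multiplication and inversion, so the same word applied
  upstairs commutes with \<open>h\<close> entry by entry.\<close>

lemma hurwitz_equiv_lift:
  assumes h: "group_hom G H h" and ts: "set ts \<subseteq> carrier G"
    and equiv: "hurwitz_equiv H (map h ts) rs"
  obtains us where "hurwitz_equiv G ts us" "map h us = rs"
proof -
  interpret group_hom G H h by fact
  obtain u where u: "u \<in> words {1..<length ts}" "foldr (hurwitz_letter H) u (map h ts) = rs"
    using equiv by (auto simp: hurwitz_equiv_def)
  have "set (foldr (hurwitz_letter G) u ts) \<subseteq> carrier G \<and>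
      map h (foldr (hurwitz_letter G) u ts) = foldr (hurwitz_letter H) u (map h ts)"
    using u(1)
  proof (induction u)
    case (Cons p u)
    define vs where "vs = foldr (hurwitz_letter G) u ts"
    have IH: "set vs \<subseteq> carrier G" "map h vs = foldr (hurwitz_letter H) u (map h ts)"
      using Cons by (auto simp: vs_def)
    obtain xs f g ys where eq: "vs = xs @ f # g # ys" "fst p = Suc (length xs)"
      using split_list_at[of "fst p" vs thesis] Cons.prems by (simp add: vs_def)
    obtain b where p: "p = (Suc (length xs), b)" using eq by (cases p) auto
    have car: "set xs \<subseteq> carrier G" "f \<in> carrier G" "g \<in> carrier G" "set ys \<subseteq> carrier G"
      using IH(1) eq by auto
    note letters = hurwitz_letter_append[of _ xs]
      hurwitz_letter_append[of H "map h xs" "h f" "h g" "map h ys", unfolded length_map]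
    have "set (hurwitz_letter G p vs) \<subseteq> carrier G"
      unfolding eq(1) p using car by (cases b) (simp_all only: letters, auto)
    moreover have "map h (hurwitz_letter G p vs) = hurwitz_letter H p (map h vs)"
      unfolding eq(1) p using car by (cases b) (simp_all only: letters map_append list.map, auto)
    ultimately show ?case using IH(2) by (simp add: vs_def)
  qed (use ts in simp)
  then show thesis
    using that u by (auto simp: hurwitz_equiv_def)
qed

section \<open>Roots and reflections\<close>

text \<open>An involution when \<open>root_form E b b = 2\<close>; this normalization, valid for all
  roots, replaces the usual denominator.\<close>

definition reflect :: "('n::finite \<Rightarrow> 'n \<Rightarrow> bool) \<Rightarrow> real ^ 'n \<Rightarrow> real ^ 'n \<Rightarrow> real ^ 'n" where
  "reflect E b v = v - root_form E b v *\<^sub>R b"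

lemma simple_reflection_eq_reflect: "simple_reflection E i = reflect E (simple_root i)"
  by (simp add: fun_eq_iff simple_reflection_def reflect_def)

definition nonneg :: "real ^ 'n \<Rightarrow> bool" where
  "nonneg v \<longleftrightarrow> (\<forall>i. 0 \<le> v $ i)"

definition integral_vec :: "real ^ 'n \<Rightarrow> bool" where
  "integral_vec v \<longleftrightarrow> (\<forall>i. v $ i \<in> \<int>)"

text \<open>The evaluation is a parameter because length is needed for products in the Coxeter group
  and, later, for linear maps. It is meaningful only on the range of \<open>ev\<close>.\<close>

definition word_length :: "('a list \<Rightarrow> 'b) \<Rightarrow> 'b \<Rightarrow> nat" where
  "word_length ev w = (LEAST k. \<exists>u. length u = k \<and> ev u = w)"

lemma word_length_le: "word_length ev (ev u) \<le> length u"
  unfolding word_length_def by (rule Least_le) blast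

lemma word_length_witness:
  obtains v where "ev v = ev u" "length v = word_length ev (ev u)"
proof -
  have "\<exists>v. length v = word_length ev (ev u) \<and> ev v = ev u"
    unfolding word_length_def by (rule LeastI[of _ "length u"]) blast
  then show thesis using that by blast
qed

lemma simple_root_nth: "simple_root i $ j = (if i = j then 1 else 0)"
  by (simp add: simple_root_def axis_def)

lemma bilinear_root_form: "bilinear (root_form E)"
  unfolding bilinear_def
  by (intro conjI allI linearI)
    (simp_all add: root_form_def algebra_simps sum.distrib sum_distrib_left)

lemmas root_form_simps =
  bilinear_ladd[OF bilinear_root_form] bilinear_radd[OF bilinear_root_form]
  bilinear_lsub[OF bilinear_root_form] bilinear_rsub[OF bilinear_root_form]
  bilinear_lmul[OF bilinear_root_form] bilinear_rmul[OF bilinear_root_form]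
  bilinear_lneg[OF bilinear_root_form] bilinear_rneg[OF bilinear_root_form]
  bilinear_lzero[OF bilinear_root_form] bilinear_rzero[OF bilinear_root_form]

lemma root_form_simple_left:
  "root_form E (simple_root i) v = (\<Sum>j\<in>UNIV. v $ j * (if i = j then 2 else if E i j then - 1 else 0))"
proof -
  have "root_form E (simple_root i) v = (\<Sum>k\<in>UNIV. if k = i then
    (\<Sum>j\<in>UNIV. v $ j * (if i = j then 2 else if E i j then - 1 else 0)) else 0)"
    unfolding root_form_def by (rule sum.cong) (auto simp: simple_root_nth intro!: sum.cong)
  then show ?thesis by simp
qed

lemma root_form_simple:
  "root_form E (simple_root i) (simple_root j) = (if i = j then 2 else if E i j then - 1 else 0)"
proof -
  have "root_form E (simple_root i) (simple_root j)
    = (\<Sum>k\<in>UNIV. if k = j then (if i = j then 2 else if E i j then - 1 else 0) else 0)"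
    unfolding root_form_simple_left by (rule sum.cong) (auto simp: simple_root_nth)
  then show ?thesis by simp
qed

lemma root_form_expand: "root_form E u v = (\<Sum>i\<in>UNIV. u $ i * root_form E (simple_root i) v)"
  unfolding root_form_simple_left by (simp add: root_form_def sum_distrib_left mult.assoc)

lemma integral_root_form:
  assumes "integral_vec u" "integral_vec v"
  shows "root_form E u v \<in> \<int>"
  using assms unfolding root_form_def integral_vec_def by (auto intro!: Ints_sum Ints_mult)

lemma linear_reflect: "linear (reflect E b)"
  by (rule linearI) (auto simp: reflect_def root_form_simps algebra_simps)

lemma reflect_simps:
  "reflect E b (u + v) = reflect E b u + reflect E b v"
  "reflect E b (u - v) = reflect E b u - reflect E b v"
  "reflect E b (c *\<^sub>R v) = c *\<^sub>R reflect E b v"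
  "reflect E b (- v) = - reflect E b v"
  by (simp_all add: linear_reflect linear_add linear_diff linear_cmul linear_neg)

lemma reflect_uminus: "reflect E (- b) = reflect E b"
  by (simp add: fun_eq_iff reflect_def root_form_simps)

locale root_graph =
  fixes E :: "'n::finite \<Rightarrow> 'n \<Rightarrow> bool"
  assumes simple_graph: "simple_graph E"
begin

abbreviation form :: "real ^ 'n \<Rightarrow> real ^ 'n \<Rightarrow> real" where "form \<equiv> root_form E"
abbreviation refl :: "real ^ 'n \<Rightarrow> real ^ 'n \<Rightarrow> real ^ 'n" where "refl \<equiv> reflect E"
abbreviation \<alpha> :: "'n \<Rightarrow> real ^ 'n" where "\<alpha> \<equiv> simple_root"
abbreviation word_map :: "'n list \<Rightarrow> real ^ 'n \<Rightarrow> real ^ 'n" where "word_map \<equiv> foldr (simple_reflection E)"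

lemma edge_sym: "E i j \<longleftrightarrow> E j i"
  using simple_graph by (auto simp: simple_graph_def symp_def)

lemma form_commute: "form u v = form v u"
proof -
  have "form u v = (\<Sum>j\<in>UNIV. \<Sum>i\<in>UNIV. u $ i * v $ j * (if i = j then 2 else if E i j then - 1 else 0))"
    unfolding root_form_def by (rule sum.swap)
  also have "\<dots> = form v u"
    unfolding root_form_def using edge_sym by (intro sum.cong refl) (auto simp: mult.commute)
  finally show ?thesis .
qed

lemma reflect_self: "form b b = 2 \<Longrightarrow> refl b b = - b"
  by (simp add: reflect_def scaleR_2)

lemma reflect_reflect: "form b b = 2 \<Longrightarrow> refl b (refl b v) = v"
  by (simp add: reflect_def root_form_simps algebra_simps flip: scaleR_add_left)

lemma form_reflect: "form b b = 2 \<Longrightarrow> form (refl b u) (refl b v) = form u v"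
  by (simp add: reflect_def root_form_simps algebra_simps form_commute[of u b])

lemma form_simple_self [simp]: "form (\<alpha> i) (\<alpha> i) = 2"
  by (simp add: root_form_simple)

lemma simple_reflection_simple:
  "simple_reflection E i (\<alpha> j) = (if i = j then - \<alpha> i else if E i j then \<alpha> j + \<alpha> i else \<alpha> j)"
  by (simp add: simple_reflection_def root_form_simple scaleR_2)

lemma simple_reflection_nth: "j \<noteq> i \<Longrightarrow> simple_reflection E i v $ j = v $ j"
  by (simp add: simple_reflection_def simple_root_nth)

lemma simple_reflection_twice [simp]: "simple_reflection E i (simple_reflection E i v) = v"
  by (simp add: simple_reflection_eq_reflect reflect_reflect)

lemma word_map_rev [simp]: "word_map (rev u) (word_map u x) = x" "word_map u (word_map (rev u) x) = x"
  by (induction u arbitrary: x) auto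

lemma word_map_linear: "linear (word_map u)"
proof (induction u)
  case Nil
  then show ?case by (simp add: linear_iff)
next
  case (Cons i u)
  then show ?case
    unfolding foldr.simps simple_reflection_eq_reflect by (intro linear_compose linear_reflect)
qed

lemmas word_map_simps = linear_add[OF word_map_linear] linear_diff[OF word_map_linear]
  linear_cmul[OF word_map_linear] linear_neg[OF word_map_linear]

lemma form_word_map: "form (word_map u x) (word_map u y) = form x y"
  by (induction u) (auto simp: simple_reflection_eq_reflect form_reflect)

lemma word_map_nth: "j \<notin> set u \<Longrightarrow> word_map u x $ j = x $ j"
  by (induction u) (auto simp: simple_reflection_nth)

lemma refl_word_map: "refl (word_map u b) (word_map u x) = word_map u (refl b x)"
  by (simp add: reflect_def form_word_map word_map_simps)

text \<open>Words stand in for group elements, so that roots are available before any group is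
  fixed; \<open>root_system_eq\<close> links them to the given root system.\<close>

definition roots :: "(real ^ 'n) set" where
  "roots = {word_map u (\<alpha> i) | u i. True}"

lemma simple_root_in_roots: "\<alpha> i \<in> roots"
proof -
  have "\<alpha> i = word_map [] (\<alpha> i)" by simp
  then show ?thesis unfolding roots_def by blast
qed

lemma word_map_in_roots: "b \<in> roots \<Longrightarrow> word_map u b \<in> roots"
proof -
  assume "b \<in> roots"
  then obtain v i where "b = word_map v (\<alpha> i)" by (auto simp: roots_def)
  then have "word_map u b = word_map (u @ v) (\<alpha> i)" by simp
  then show ?thesis unfolding roots_def by blast
qed

lemma form_root [simp]: "b \<in> roots \<Longrightarrow> form b b = 2"
  by (auto simp: roots_def form_word_map)

lemma uminus_in_roots: "b \<in> roots \<Longrightarrow> - b \<in> roots"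
proof -
  assume "b \<in> roots"
  then obtain u i where "b = word_map u (\<alpha> i)" by (auto simp: roots_def)
  then have "- b = word_map (u @ [i]) (\<alpha> i)"
    by (simp add: simple_reflection_simple word_map_simps)
  then show ?thesis unfolding roots_def by blast
qed

lemma refl_root_word:
  assumes "b \<in> roots"
  obtains u where "refl b = word_map u"
proof -
  obtain u i where b: "b = word_map u (\<alpha> i)"
    using assms by (auto simp: roots_def)
  have "refl b x = word_map (u @ [i] @ rev u) x" for x
    using refl_word_map[of u "\<alpha> i" "word_map (rev u) x"] by (simp add: b simple_reflection_eq_reflect)
  then show thesis using that by blast
qed

lemma refl_in_roots: "\<lbrakk>b \<in> roots; a \<in> roots\<rbrakk> \<Longrightarrow> refl b a \<in> roots"
  by (metis refl_root_word word_map_in_roots)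

text \<open>Integrality is what later turns a form value above 1 into one that is at least 2, a
  positive one into one that is at least 1, and a coefficient dividing 1 into a sign.\<close>

lemma integral_root:
  assumes "b \<in> roots"
  shows "integral_vec b"
proof -
  have simple: "integral_vec (\<alpha> j)" for j
    by (simp add: integral_vec_def simple_root_nth)
  have "integral_vec (simple_reflection E j x)" if "integral_vec x" for j x
    using that integral_root_form[OF simple that]
    by (simp add: integral_vec_def simple_reflection_def simple_root_nth)
  then have "integral_vec (word_map u (\<alpha> i))" for u i
    by (induction u) (simp_all add: simple)
  then show ?thesis using assms by (auto simp: roots_def)
qed

lemma nonneg_not_both: "\<lbrakk>nonneg b; nonneg (- b)\<rbrakk> \<Longrightarrow> b = 0"
  by (simp add: nonneg_def vec_eq_iff order_antisym)

lemma root_not_both: "b \<in> roots \<Longrightarrow> \<not> (nonneg b \<and> nonneg (- b))"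
  using nonneg_not_both[of b] form_root[of b] by (metis root_form_simps(9) zero_neq_numeral)

end


section \<open>The geometric representation is faithful\<close>

text \<open>An interface that hides the presentation: the relations allow rewriting of words, and
  \<open>s_represent\<close> says that the geometric representation is well defined.\<close>

locale coxeter_geometry = root_graph E + group W
  for E :: "'n::finite \<Rightarrow> 'n \<Rightarrow> bool" and W :: "('w, 'b) monoid_scheme" (structure) +
  fixes s :: "'n \<Rightarrow> 'w"
  assumes s_closed [simp]: "s i \<in> carrier W"
    and s_square: "s i \<otimes> s i = \<one>"
    and s_commute: "\<lbrakk>i \<noteq> j; \<not> E i j\<rbrakk> \<Longrightarrow> s i \<otimes> s j = s j \<otimes> s i"
    and s_braid: "E i j \<Longrightarrow> s i \<otimes> (s j \<otimes> s i) = s j \<otimes> (s i \<otimes> s j)"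
    and s_generate: "w \<in> carrier W \<Longrightarrow> \<exists>u. w = group_prod W (map s u)"
    and s_represent: "group_prod W (map s u) = group_prod W (map s v) \<Longrightarrow>
      foldr (simple_reflection E) u = foldr (simple_reflection E) v"
begin

abbreviation word_prod :: "'n list \<Rightarrow> 'w" where "word_prod u \<equiv> group_prod W (map s u)"

lemma s_image_closed [simp]: "s ` A \<subseteq> carrier W"
  by auto

lemma word_prod_closed [simp]: "word_prod u \<in> carrier W"
  by simp

lemma word_prod_append: "word_prod (u @ v) = word_prod u \<otimes> word_prod v"
  by (simp add: group_prod_append)

abbreviation len :: "'n list \<Rightarrow> nat" where "len u \<equiv> word_length word_prod (word_prod u)"

lemma len_append_le: "len (u @ v) \<le> len u + length v"
proof -
  obtain x where x: "word_prod x = word_prod u" "length x = len u"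
    using word_length_witness[of word_prod u] by blast
  then have "word_prod (u @ v) = word_prod (x @ v)" by (simp only: word_prod_append)
  then show ?thesis using word_length_le[of word_prod "x @ v"] x(2) by simp
qed

lemma word_prod_cong: "word_prod u = word_prod v \<Longrightarrow> word_prod (x @ u @ y) = word_prod (x @ v @ y)"
  by (simp only: word_prod_append)

lemma word_prod_square: "word_prod [i, i] = word_prod []"
  by (simp add: s_square)

text \<open>Strip the last letter t of a shortest word x t for u and argue in the rank two subgroup
  of t and i. If they commute, u sends \<open>\<alpha> i\<close> where x does. If they are adjacent,
  its image is the sum of the images of \<open>\<alpha> i\<close> and \<open>\<alpha> t\<close>
  under x, which are both nonnegative unless i shortens x; then it equals the image of
  \<open>\<alpha> t\<close> under x i. The weak inequality in the hypothesis avoids a discussion of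
  parity.\<close>

lemma nonneg_if_length_increases: "len u \<le> len (u @ [i]) \<Longrightarrow> nonneg (word_map u (\<alpha> i))"
proof (induction "len u" arbitrary: u i rule: less_induct)
  case less
  obtain v where v: "word_prod v = word_prod u" "length v = len u"
    using word_length_witness[of word_prod u] by blast
  have vu: "word_map v = word_map u" by (rule s_represent[OF v(1)])
  show ?case
  proof (cases v rule: rev_cases)
    case Nil
    then show ?thesis using vu by (auto simp: nonneg_def simple_root_nth fun_eq_iff)
  next
    case (snoc x t)
    have ui: "word_prod (u @ [i]) = word_prod (x @ [t, i])"
      using v(1) snoc by (simp add: group_prod_append flip: m_assoc)
    have len_x: "Suc (len x) \<le> len u"
      using word_length_le[of word_prod x] v(2) snoc by simp
    have len_xt: "len (x @ [t]) = len u" using v(1) snoc by simp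
    have map_u: "word_map u (\<alpha> i) = word_map x (simple_reflection E t (\<alpha> i))"
      using snoc by (simp flip: vu)
    have "t \<noteq> i"
    proof
      assume "t = i"
      then have "word_prod (u @ [i]) = word_prod x"
        using ui word_prod_cong[OF word_prod_square, of x i "[]"] by simp
      then show False using less.prems len_x by simp
    qed
    show ?thesis
    proof (cases "E t i")
      case False
      have "word_prod [t, i] = word_prod [i, t]" using s_commute \<open>t \<noteq> i\<close> False by simp
      then have "word_prod (u @ [i]) = word_prod ((x @ [i]) @ [t])"
        using ui word_prod_cong[of "[t, i]" "[i, t]" x "[]"] by simp
      then have "len (u @ [i]) \<le> len (x @ [i]) + 1"
        using len_append_le[of "x @ [i]" "[t]"] by simp
      then have "len x \<le> len (x @ [i])" using less.prems len_x by simp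
      then have "nonneg (word_map x (\<alpha> i))" using less.hyps[of x i] len_x by simp
      then show ?thesis using map_u False \<open>t \<noteq> i\<close> by (simp add: simple_reflection_simple)
    next
      case True
      have pos_t: "nonneg (word_map x (\<alpha> t))" using less.hyps[of x t] len_x len_xt by simp
      have map_u': "word_map u (\<alpha> i) = word_map x (\<alpha> i) + word_map x (\<alpha> t)"
        using map_u True \<open>t \<noteq> i\<close> by (simp add: simple_reflection_simple word_map_simps)
      show ?thesis
      proof (cases "len x \<le> len (x @ [i])")
        case True
        then have "nonneg (word_map x (\<alpha> i))" using less.hyps[of x i] len_x by simp
        then show ?thesis using pos_t map_u' by (simp add: nonneg_def)
      next
        case False
        define y where "y = x @ [i]"
        \<comment> \<open>Inserting i i and braiding gives u i = (y t)(i t) with y = x i. As y is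
          shorter than u by at least two, t cannot shorten y.\<close>
        have "word_prod [t, i] = word_prod [i, i, t, i]"
          using word_prod_cong[OF word_prod_square, of "[]" i "[t, i]"] by simp
        also have "\<dots> = word_prod [i, t, i, t]"
          using s_braid[OF \<open>E t i\<close>] by simp
        finally have "word_prod (u @ [i]) = word_prod ((y @ [t]) @ [i, t])"
          using ui word_prod_cong[of "[t, i]" "[i, t, i, t]" x "[]"] by (simp add: y_def)
        then have "len (u @ [i]) \<le> len (y @ [t]) + 2"
          using len_append_le[of "y @ [t]" "[i, t]"] by simp
        then have "len y \<le> len (y @ [t])"
          using less.prems len_x False by (simp add: y_def)
        then have "nonneg (word_map y (\<alpha> t))"
          using less.hyps[of y t] len_x False by (simp add: y_def)
        moreover have "word_map y (\<alpha> t) = word_map u (\<alpha> i)"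
          using map_u' True \<open>t \<noteq> i\<close> edge_sym[of t i]
          by (simp add: y_def simple_reflection_simple word_map_simps)
        ultimately show ?thesis by simp
      qed
    qed
  qed
qed

text \<open>Appending i twice returns to u, so at least one of the two appendings does not shorten.
  The second one yields the negative of the root.\<close>

lemma root_nonneg_or_nonpos:
  assumes "b \<in> roots"
  shows "nonneg b \<or> nonneg (- b)"
proof -
  obtain u i where b: "b = word_map u (\<alpha> i)"
    using assms by (auto simp: roots_def)
  have "word_prod (u @ [i, i]) = word_prod u"
    using word_prod_cong[OF word_prod_square, of u i "[]"] by simp
  then have "len u \<le> len (u @ [i]) \<or> len (u @ [i]) \<le> len ((u @ [i]) @ [i])" by auto
  then show ?thesis
    using nonneg_if_length_increases[of u i] nonneg_if_length_increases[of "u @ [i]" i]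
    by (auto simp: b simple_reflection_simple word_map_simps)
qed

lemma word_prod_rev: "word_prod (u @ rev u) = \<one>"
proof (induction u)
  case (Cons i u)
  have "word_prod ((i # u) @ rev (i # u)) = s i \<otimes> (word_prod (u @ rev u) \<otimes> s i)"
    by (simp add: group_prod_append m_assoc)
  then show ?case using Cons by (simp add: s_square)
qed simp

text \<open>If a nonempty shortest word x t acted as the identity, x would send
  \<open>\<alpha> t\<close> to its negative, although t does not shorten x.\<close>

lemma word_prod_one_if_word_map_id:
  assumes "word_map u = id"
  shows "word_prod u = \<one>"
proof -
  obtain v where v: "word_prod v = word_prod u" "length v = len u"
    using word_length_witness[of word_prod u] by blast
  have vu: "word_map v = id" using s_represent[OF v(1)] assms by simp
  show ?thesis
  proof (cases v rule: rev_cases)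
    case Nil
    then show ?thesis using v(1) by simp
  next
    case (snoc x t)
    have "len x \<le> len (x @ [t])"
      using word_length_le[of word_prod x] v snoc by simp
    then have "nonneg (word_map x (\<alpha> t))" by (rule nonneg_if_length_increases)
    moreover have "word_map x (\<alpha> t) = - \<alpha> t"
      using fun_cong[OF vu, of "- \<alpha> t"] snoc
      by (simp add: simple_reflection_simple linear_neg[OF word_map_linear[of "[t]"], simplified])
    ultimately show ?thesis by (simp add: nonneg_def simple_root_nth) (metis not_one_le_zero neg_0_le_iff_le)
  qed
qed

lemma word_prod_eq_iff: "word_prod u = word_prod v \<longleftrightarrow> word_map u = word_map v"
proof
  assume "word_map u = word_map v"
  then have "word_map (rev v @ u) = id" by (simp add: fun_eq_iff)
  then have "word_prod (rev v @ u) = \<one>" by (rule word_prod_one_if_word_map_id)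
  moreover have "word_prod v \<otimes> word_prod (rev v @ u) = word_prod u"
    using word_prod_rev[of v] by (simp add: word_prod_append del: map_append flip: m_assoc)
  ultimately show "word_prod u = word_prod v" by simp
qed (rule s_represent)

end

text \<open>The isomorphism is used in both directions: relators hold in W, and an equality of
  products in W is a consequence of the relators, hence is respected by every action that satisfies
  them.\<close>

lemma coxeter_geometry_if_coxeter_system:
  fixes W :: "('w, 'b) monoid_scheme" and s :: "'n::finite \<Rightarrow> 'w"
  assumes graph: "simple_graph E" and cox: "coxeter_system W s (simply_laced_matrix E)"
  shows "coxeter_geometry E W s"
proof -
  let ?M = "simply_laced_matrix E"
  let ?R = "coxeter_relators ?M"
  let ?P = "presented_group UNIV ?R"
  let ?cl = "word_class UNIV ?R"
  interpret root_graph E by unfold_locales fact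
  interpret W: group W using cox by (simp add: coxeter_system_def)
  interpret P: group ?P by (rule group_presented_group)
  obtain h where h: "h \<in> iso ?P W" "\<And>i. h (?cl [(i, True)]) = s i"
    using cox by (auto simp: coxeter_system_def)
  have words: "w \<in> words UNIV" for w :: "('n \<times> bool) list" by (induction w) auto
  note cl_closed = word_class_carrier[OF words, where R = ?R]
  have h_closed: "h A \<in> carrier W" if "A \<in> carrier ?P" for A
    using h(1) that by (auto simp: iso_def hom_def)
  have h_append: "h (?cl (u @ v)) = h (?cl u) \<otimes>\<^bsub>W\<^esub> h (?cl v)" for u v
    using h(1) cl_closed by (simp add: iso_def hom_def flip: presented_group_mult[OF words words])
  have h_nil: "h (?cl []) = \<one>\<^bsub>W\<^esub>"
    using h_append[of "[]" "[]"] h_closed[OF cl_closed[of "[]"]] W.l_cancel_one by simp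
  have closed: "s i \<in> carrier W" for i
    using h_closed[OF cl_closed[of "[(i, True)]"]] h(2) by simp
  let ?pos = "map (\<lambda>i. (i, True))"
  have h_pos: "h (?cl (?pos u)) = group_prod W (map s u)" for u
  proof (induction u)
    case (Cons i u)
    then show ?case using h_append[of "[(i, True)]" "?pos u"] h(2) by simp
  qed (simp add: h_nil)
  have cl_eq: "?cl u = ?cl v" if "reduces UNIV ?R u v" for u v
    using that words by (subst word_class_eq_iff) (auto simp: word_rel_def)
  have rel: "group_prod W (map s (concat (replicate (?M i j) [i, j]))) = \<one>\<^bsub>W\<^esub>" for i j
  proof -
    let ?r = "concat (replicate (?M i j) [(i, True), (j, True)])"
    have "?M i j \<noteq> 0" by (simp add: simply_laced_matrix_def)
    then have "?r \<in> ?R" unfolding coxeter_relators_def by blast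
    then have "?cl ?r = ?cl []" using reduces.relator[of ?r ?R UNIV "[]" "[]"] by (intro cl_eq) simp
    moreover have "?pos (concat (replicate (?M i j) [i, j])) = ?r" by (simp add: map_concat)
    ultimately show ?thesis using h_pos h_nil by metis
  qed
  have square: "s i \<otimes>\<^bsub>W\<^esub> s i = \<one>\<^bsub>W\<^esub>" for i
    using rel[of i i] closed by (simp add: simply_laced_matrix_def)
  have inv_s: "inv\<^bsub>W\<^esub> (s i) = s i" for i
    by (rule W.inv_equality) (use square closed in auto)
  have commute: "s i \<otimes>\<^bsub>W\<^esub> s j = s j \<otimes>\<^bsub>W\<^esub> s i" if "i \<noteq> j" "\<not> E i j" for i j
  proof -
    have "(s i \<otimes>\<^bsub>W\<^esub> s j) \<otimes>\<^bsub>W\<^esub> (s i \<otimes>\<^bsub>W\<^esub> s j) = \<one>\<^bsub>W\<^esub>"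
      using rel[of i j] that closed by (simp add: simply_laced_matrix_def numeral_2_eq_2 W.m_assoc)
    then have "inv\<^bsub>W\<^esub> (s i \<otimes>\<^bsub>W\<^esub> s j) = s i \<otimes>\<^bsub>W\<^esub> s j"
      by (rule W.inv_equality) (use closed in auto)
    then show ?thesis using closed by (simp add: W.inv_mult_group inv_s)
  qed
  have braid: "s i \<otimes>\<^bsub>W\<^esub> (s j \<otimes>\<^bsub>W\<^esub> s i) = s j \<otimes>\<^bsub>W\<^esub> (s i \<otimes>\<^bsub>W\<^esub> s j)" if "E i j" for i j
  proof -
    have "i \<noteq> j" using that graph by (auto simp: simple_graph_def irreflp_def)
    then have "(s i \<otimes>\<^bsub>W\<^esub> (s j \<otimes>\<^bsub>W\<^esub> s i)) \<otimes>\<^bsub>W\<^esub> (s j \<otimes>\<^bsub>W\<^esub> (s i \<otimes>\<^bsub>W\<^esub> s j)) = \<one>\<^bsub>W\<^esub>"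
      using rel[of i j] that closed by (simp add: simply_laced_matrix_def numeral_3_eq_3 W.m_assoc)
    then have "inv\<^bsub>W\<^esub> (s j \<otimes>\<^bsub>W\<^esub> (s i \<otimes>\<^bsub>W\<^esub> s j)) = s i \<otimes>\<^bsub>W\<^esub> (s j \<otimes>\<^bsub>W\<^esub> s i)"
      by (rule W.inv_equality) (use closed in auto)
    then show ?thesis using closed by (simp add: W.inv_mult_group inv_s W.m_assoc)
  qed
  \<comment> \<open>Squares of generators are relators, so formal inverses can be replaced by
    generators and positive words generate W.\<close>
  have cl_sign: "?cl [(i, b)] = ?cl [(i, True)]" for i b
  proof (cases b)
    case False
    have "[(i, True), (i, True)] \<in> ?R"
      by (auto simp: coxeter_relators_def simply_laced_matrix_def intro!: exI[of _ i])
    then have "?cl [(i, False), (i, True), (i, True)] = ?cl [(i, False)]"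
      using reduces.relator[of "[(i, True), (i, True)]" ?R UNIV "[(i, False)]" "[]"] by (intro cl_eq) simp
    moreover have "?cl [(i, False), (i, True), (i, True)] = ?cl [(i, True)]"
      using reduces.cancel[of i UNIV ?R "[]" False "[(i, True)]"] by (intro cl_eq) simp
    ultimately show ?thesis using False by simp
  qed simp
  have generate: "\<exists>u. w = group_prod W (map s u)" if "w \<in> carrier W" for w
  proof -
    obtain A where "A \<in> carrier ?P" "w = h A"
      using h(1) \<open>w \<in> carrier W\<close> by (auto simp: iso_def bij_betw_def)
    then obtain x where x: "w = h (?cl x)" by (metis presented_group_carrierE)
    have "h (?cl x) = group_prod W (map s (map fst x))"
    proof (induction x)
      case (Cons p x)
      then show ?case
        using h_append[of "[p]" x] h(2)[of "fst p"] cl_sign[of "fst p" "snd p"] by simp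
    qed (simp add: h_nil)
    then show ?thesis using x by blast
  qed
  have represent: "word_map u = word_map v" if "group_prod W (map s u) = group_prod W (map s v)" for u v
  proof
    fix p
    have "?cl (?pos u) = ?cl (?pos v)"
      using h(1) that h_pos cl_closed by (auto simp: iso_def bij_betw_def inj_on_def)
    then have uv: "(?pos u, ?pos v) \<in> word_rel UNIV ?R" by (simp add: word_class_eq_iff words)
    \<comment> \<open>A letter and its formal inverse may act alike because simple reflections are
      involutions.\<close>
    have "foldr (\<lambda>(i, b). simple_reflection E i) (?pos u) p = foldr (\<lambda>(i, b). simple_reflection E i) (?pos v) p"
    proof (rule foldr_word_rel_invariant[OF _ _ _ _ uv, where Y = UNIV])
      fix r p assume "r \<in> ?R"
      then obtain i j where r: "r = concat (replicate (?M i j) [(i, True), (j, True)])"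
        by (auto simp: coxeter_relators_def)
      have "E j i \<longleftrightarrow> E i j" "\<not> E i i"
        using edge_sym graph by (auto simp: simple_graph_def irreflp_def)
      then show "foldr (\<lambda>(i, b). simple_reflection E i) r p = p"
        by (auto simp: r simply_laced_matrix_def numeral_2_eq_2 numeral_3_eq_3 simple_reflection_def
            root_form_simps root_form_simple algebra_simps)
    qed (use words in auto)
    then show "word_map u p = word_map v p" by (simp add: foldr_map o_def)
  qed
  show ?thesis
    by unfold_locales (fact closed square commute braid generate represent)+
qed

section \<open>Exchange condition and peaks\<close>

context coxeter_geometry
begin

abbreviation map_len :: "(real ^ 'n \<Rightarrow> real ^ 'n) \<Rightarrow> nat" where "map_len \<equiv> word_length word_map"

text \<open>The simple reflection alters only coordinate i, so every other coordinate is both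
  nonnegative and nonpositive. A root has norm 2, which leaves coefficient 1 at i.\<close>

lemma root_eq_simple_if_reflected_nonpos:
  assumes "g \<in> roots" "nonneg g" "nonneg (- simple_reflection E i g)"
  shows "g = \<alpha> i"
proof -
  have "g $ j = 0" if "j \<noteq> i" for j
    using assms(2,3) that simple_reflection_nth[OF that, of g] unfolding nonneg_def
    by (metis neg_0_le_iff_le order_antisym vector_uminus_component)
  then have g: "g = g $ i *\<^sub>R \<alpha> i"
    by (auto simp: vec_eq_iff simple_root_nth)
  have "form g g = g $ i * (g $ i * 2)"
    by (subst (1 2) g) (simp add: root_form_simps)
  then have "(g $ i)\<^sup>2 = 1"
    using assms(1) by (simp add: power2_eq_square)
  then have "g $ i = 1"
    using assms(2) unfolding nonneg_def by (metis abs_of_nonneg abs_one power2_eq_iff_nonneg power_one zero_le_one)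
  then show ?thesis using g by simp
qed

text \<open>Apply the letters of \<open>u\<close> to \<open>b\<close> from the right. At the letter
  where the sign turns, the current root must be the simple root of that letter.\<close>

lemma exchange:
  assumes "b \<in> roots" "nonneg b" "nonneg (- word_map u b)"
  obtains x i y where "u = x @ i # y" "word_map y b = \<alpha> i"
proof -
  have "\<exists>x i y. u = x @ i # y \<and> word_map y b = \<alpha> i"
    using assms(3)
  proof (induction u)
    case Nil
    then show ?case using assms root_not_both by simp
  next
    case (Cons i u)
    show ?case
    proof (cases "nonneg (- word_map u b)")
      case True
      then obtain x k y where "u = x @ k # y" "word_map y b = \<alpha> k" using Cons.IH by blast
      then have "i # u = (i # x) @ k # y" "word_map y b = \<alpha> k" by auto
      then show ?thesis by blast
    next
      case False
      have "word_map u b = \<alpha> i"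
      proof (rule root_eq_simple_if_reflected_nonpos)
        show root: "word_map u b \<in> roots" using assms(1) by (rule word_map_in_roots)
        show "nonneg (word_map u b)" using root_nonneg_or_nonpos[OF root] False by blast
        show "nonneg (- simple_reflection E i (word_map u b))" using Cons.prems by simp
      qed
      then show ?thesis by blast
    qed
  qed
  then show thesis using that by blast
qed

lemma exchange_word_map:
  assumes "word_map y b = \<alpha> i"
  shows "word_map (x @ i # y) \<circ> refl b = word_map (x @ y)"
proof
  fix v
  have "word_map y (refl b v) = simple_reflection E i (word_map y v)"
    by (simp add: simple_reflection_eq_reflect flip: assms refl_word_map)
  then show "(word_map (x @ i # y) \<circ> refl b) v = word_map (x @ y) v" by simp
qed

lemma map_len_less_if_nonpos:
  assumes b: "b \<in> roots" "nonneg b" "nonneg (- f b)" and f: "f \<in> range word_map"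
  shows "map_len (f \<circ> refl b) < map_len f"
proof -
  obtain u where u: "word_map u = f" "length u = map_len f"
    using f word_length_witness[of word_map] by (metis rangeE)
  obtain x i y where "u = x @ i # y" "word_map y b = \<alpha> i"
    using exchange[of b u] b u by metis
  then have "f \<circ> refl b = word_map (x @ y)" "length (x @ y) < map_len f"
    using exchange_word_map u by auto
  then show ?thesis using word_length_le[of word_map "x @ y"] by simp
qed

lemma range_word_map_refl:
  assumes "f \<in> range word_map" "b \<in> roots"
  shows "f \<circ> refl b \<in> range word_map"
proof -
  obtain u v where "f = word_map u" "refl b = word_map v"
    using assms refl_root_word by blast
  then have "f \<circ> refl b = word_map (u @ v)" by (simp add: fun_eq_iff)
  then show ?thesis by blast
qed

lemma range_word_map_in_roots: "\<lbrakk>f \<in> range word_map; b \<in> roots\<rbrakk> \<Longrightarrow> f b \<in> roots"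
  using word_map_in_roots by blast

lemma range_word_map_uminus: "f \<in> range word_map \<Longrightarrow> f (- b) = - f b"
  using word_map_simps(4) by blast

lemma refl_comp_refl: "b \<in> roots \<Longrightarrow> refl b \<circ> refl b = id"
  by (simp add: fun_eq_iff reflect_reflect)

text \<open>Passing from \<open>f\<close> to \<open>f\<close> composed with the reflection negates
  the image of \<open>b\<close>, so the ascent case is the descent case for the composite.\<close>

lemma map_len_refl_cases:
  assumes b: "b \<in> roots" "nonneg b" and f: "f \<in> range word_map"
  shows "map_len (f \<circ> refl b) < map_len f \<and> nonneg (- f b) \<or> map_len f < map_len (f \<circ> refl b) \<and> nonneg (f b)"
proof (cases "nonneg (- f b)")
  case True
  then show ?thesis using map_len_less_if_nonpos b f by blast
next
  case False
  then have pos: "nonneg (f b)"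
    using root_nonneg_or_nonpos range_word_map_in_roots b f by blast
  then have "nonneg (- (f \<circ> refl b) b)"
    using b f by (simp add: reflect_self range_word_map_uminus)
  then have "map_len (f \<circ> refl b \<circ> refl b) < map_len (f \<circ> refl b)"
    using map_len_less_if_nonpos b range_word_map_refl[OF f b(1)] by blast
  then show ?thesis using pos refl_comp_refl[OF b(1)] by (simp add: comp_assoc)
qed

section \<open>Inversion sets and the lowering of a peak\<close>

definition inversions :: "(real ^ 'n \<Rightarrow> real ^ 'n) \<Rightarrow> (real ^ 'n) set" where
  "inversions f = {b \<in> roots. nonneg b \<and> nonneg (- f b)}"

text \<open>Exchange assigns to each inversion a position in the word, and the position determines
  the inversion. Finiteness is what ends the recursion in \<open>peak_reduction_aux\<close>.\<close>

lemma finite_inversions: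
  assumes "f \<in> range word_map"
  shows "finite (inversions f)"
proof -
  obtain u where u: "f = word_map u" using assms by blast
  have "inversions f \<subseteq> (\<lambda>k. word_map (rev (drop (Suc k) u)) (\<alpha> (u ! k))) ` {..<length u}"
  proof
    fix b assume "b \<in> inversions f"
    then obtain x i y where xy: "u = x @ i # y" "word_map y b = \<alpha> i"
      using exchange[of b u] by (auto simp: inversions_def u)
    then have "b = word_map (rev y) (\<alpha> i)" by (metis word_map_rev(1))
    then show "b \<in> (\<lambda>k. word_map (rev (drop (Suc k) u)) (\<alpha> (u ! k))) ` {..<length u}"
      using xy(1) by (intro image_eqI[of _ _ "length x"]) auto
  qed
  then show ?thesis by (rule finite_subset) simp
qed

lemma refl_refl_comp:
  assumes "a \<in> roots"
  shows "refl (refl a b) = refl a \<circ> refl b \<circ> refl a"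
proof
  fix x
  obtain u where u: "refl a = word_map u" using assms by (rule refl_root_word)
  have "refl (refl a b) (refl a (refl a x)) = refl a (refl b (refl a x))"
    unfolding u by (rule refl_word_map)
  then show "refl (refl a b) x = (refl a \<circ> refl b \<circ> refl a) x"
    using assms by (simp add: reflect_reflect)
qed

text \<open>The roots \<open>\<dots>, b, a, form a b *\<^sub>R a - b, \<dots>\<close> of the rank two subsystem spanned by \<open>a\<close> and \<open>b\<close> satisfy a
  linear recurrence and consecutive ones have the same product of reflections. If the claim failed
  for \<open>(a, b)\<close>, it would fail all along this sequence, which would then consist of
  inversions with a strictly increasing coordinate.\<close>

lemma peak_reduction_aux:
  assumes f: "f \<in> range word_map"
    and "a \<in> inversions f" "b \<in> inversions f" "b $ j < a $ j"
  shows "map_len (f \<circ> refl a \<circ> refl b) < map_len f \<or> map_len (f \<circ> refl b \<circ> refl a) < map_len f"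
  using assms(2-)
proof (induction "card {x \<in> inversions f. a $ j < x $ j}" arbitrary: a b rule: less_induct)
  case less
  have a: "a \<in> roots" "nonneg a" "nonneg (- f a)" and b: "b \<in> roots" "nonneg b" "nonneg (- f b)"
    using less.prems by (auto simp: inversions_def)
  have fa: "map_len (f \<circ> refl a) < map_len f" "f \<circ> refl a \<in> range word_map"
    and fb: "map_len (f \<circ> refl b) < map_len f" "f \<circ> refl b \<in> range word_map"
    using a b f map_len_less_if_nonpos range_word_map_refl by auto
  have ab: "refl a b \<in> roots" "refl b a \<in> roots"
    using a b refl_in_roots by auto
  \<comment> \<open>Rewriting each product with the other reflection first makes the sign of
    \<open>refl a b\<close> or \<open>refl b a\<close> itself, and not only of its image under
    \<open>f\<close>, decide whether the second step descends.\<close>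
  have swap: "f \<circ> refl b \<circ> refl a = f \<circ> refl a \<circ> refl (refl a b)"
    "f \<circ> refl a \<circ> refl b = f \<circ> refl b \<circ> refl (refl b a)"
    using a b refl_comp_refl by (simp_all add: refl_refl_comp fun_eq_iff reflect_reflect)
  consider "nonneg (- f (refl a b))" | "nonneg (- f (refl b a))" | "nonneg (refl a b)" | "nonneg (refl b a)"
    | (rec) "\<not> nonneg (- f (refl a b))" "\<not> nonneg (- f (refl b a))" "\<not> nonneg (refl a b)" "\<not> nonneg (refl b a)"
    by blast
  then show ?case
  proof cases
    case 1
    then have "map_len (f \<circ> refl a \<circ> refl b) < map_len (f \<circ> refl a)"
      using map_len_less_if_nonpos[of b "f \<circ> refl a"] b fa by simp
    then show ?thesis using fa by simp
  next
    case 2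
    then have "map_len (f \<circ> refl b \<circ> refl a) < map_len (f \<circ> refl b)"
      using map_len_less_if_nonpos[of a "f \<circ> refl b"] a fb by simp
    then show ?thesis using fb by simp
  next
    case 3
    then have "map_len (f \<circ> refl a \<circ> refl (refl a b)) < map_len (f \<circ> refl a)"
      using map_len_less_if_nonpos[of "refl a b" "f \<circ> refl a"] a b ab fa by (simp add: reflect_reflect)
    then show ?thesis using fa by (simp add: swap)
  next
    case 4
    then have "map_len (f \<circ> refl b \<circ> refl (refl b a)) < map_len (f \<circ> refl b)"
      using map_len_less_if_nonpos[of "refl b a" "f \<circ> refl b"] a b ab fb by (simp add: reflect_reflect)
    then show ?thesis using fb by (simp add: swap)
  next
    case rec
    \<comment> \<open>The roots beyond \<open>a\<close> and beyond \<open>b\<close> in the sequence.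
      In the remaining case both are nonnegative.\<close>
    define c d where "c = - refl a b" and "d = - refl b a"
    have cd: "c \<in> roots" "nonneg c" "d \<in> roots" "nonneg d"
      using ab rec root_nonneg_or_nonpos by (auto simp: c_def d_def uminus_in_roots)
    have "nonneg (f (refl a b))"
      using root_nonneg_or_nonpos[OF range_word_map_in_roots[OF f ab(1)]] rec by blast
    then have c: "c \<in> inversions f"
      using cd by (simp add: inversions_def c_def range_word_map_uminus[OF f])
    \<comment> \<open>At coordinate j the left side is nonnegative and \<open>a + b\<close> is
      positive, so the form value is at least 1. The value 1 would make \<open>c\<close> and
      \<open>d\<close> opposite, which nonnegative roots cannot be.\<close>
    have sum: "c + d = (form a b - 1) *\<^sub>R (a + b)"
      by (simp add: c_def d_def reflect_def form_commute[of b a] algebra_simps)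
    have pos: "0 < a $ j + b $ j"
      using less.prems(3) b(2) nonneg_def[of b] by (smt (verit))
    have "0 \<le> (c + d) $ j"
      using cd by (simp add: nonneg_def)
    then have "1 \<le> form a b"
      using pos unfolding sum by (simp add: zero_le_mult_iff)
    moreover have "form a b \<noteq> 1"
    proof
      assume "form a b = 1"
      then have "- c = d" using sum by (simp add: eq_neg_iff_add_eq_0 minus_unique)
      then show False using cd root_not_both by blast
    qed
    moreover obtain k :: int where "form a b = of_int k"
      using integral_root_form integral_root a b by (metis Ints_cases)
    ultimately have k: "2 \<le> form a b" by auto
    then have "2 * a $ j \<le> form a b * a $ j"
      using a by (intro mult_right_mono) (auto simp: nonneg_def)
    then have cj: "a $ j < c $ j"
      using less.prems(3) by (simp add: c_def reflect_def)
    \<comment> \<open>The inversion \<open>c\<close> is counted in the larger set but not in the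
      smaller one.\<close>
    have "{x \<in> inversions f. c $ j < x $ j} \<subset> {x \<in> inversions f. a $ j < x $ j}"
      using c cj by auto
    then have "card {x \<in> inversions f. c $ j < x $ j} < card {x \<in> inversions f. a $ j < x $ j}"
      by (intro psubset_card_mono) (simp add: finite_inversions f)
    then have "map_len (f \<circ> refl c \<circ> refl a) < map_len f \<or> map_len (f \<circ> refl a \<circ> refl c) < map_len f"
      using less.hyps[of c a] c less.prems(1) cj by blast
    moreover have "refl c = refl a \<circ> refl b \<circ> refl a"
      unfolding c_def reflect_uminus using a(1) by (rule refl_refl_comp)
    then have "f \<circ> refl c \<circ> refl a = f \<circ> refl a \<circ> refl b" "f \<circ> refl a \<circ> refl c = f \<circ> refl b \<circ> refl a"
      using a by (simp_all add: fun_eq_iff reflect_reflect)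
    ultimately show ?thesis by auto
  qed
qed

lemma peak_reduction:
  assumes f: "f \<in> range word_map" and "a \<in> inversions f" "b \<in> inversions f" "a \<noteq> b"
  shows "map_len (f \<circ> refl a \<circ> refl b) < map_len f \<or> map_len (f \<circ> refl b \<circ> refl a) < map_len f"
proof -
  obtain j where "a $ j \<noteq> b $ j" using \<open>a \<noteq> b\<close> by (auto simp: vec_eq_iff)
  then consider "b $ j < a $ j" | "a $ j < b $ j" by linarith
  then show ?thesis using peak_reduction_aux assms by cases blast+
qed


section \<open>Factorizations in the geometric representation\<close>

definition linear_group :: "(real ^ 'n \<Rightarrow> real ^ 'n) monoid" where
  "linear_group = \<lparr>carrier = range word_map, mult = (\<circ>), one = id\<rparr>"

definition linear_reflections :: "(real ^ 'n \<Rightarrow> real ^ 'n) set" where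
  "linear_reflections = refl ` roots"

lemma linear_group_simps [simp]:
  "carrier linear_group = range word_map"
  "f \<otimes>\<^bsub>linear_group\<^esub> g = f \<circ> g"
  "\<one>\<^bsub>linear_group\<^esub> = id"
  by (simp_all add: linear_group_def)

lemma word_map_comp: "word_map u \<circ> word_map v = word_map (u @ v)"
  by (simp add: fun_eq_iff)

lemma group_linear_group: "group linear_group"
proof (rule groupI)
  fix f assume "f \<in> carrier linear_group"
  then obtain u where "f = word_map u" by auto
  then have "word_map (rev u) \<otimes>\<^bsub>linear_group\<^esub> f = \<one>\<^bsub>linear_group\<^esub>"
    by (simp add: fun_eq_iff)
  then show "\<exists>g\<in>carrier linear_group. g \<otimes>\<^bsub>linear_group\<^esub> f = \<one>\<^bsub>linear_group\<^esub>"
    by auto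
next
  have "id = word_map []" by (simp add: fun_eq_iff)
  then have "id \<in> range word_map" by (rule range_eqI)
  then show "\<one>\<^bsub>linear_group\<^esub> \<in> carrier linear_group" by simp
qed (auto simp: word_map_comp comp_assoc simp del: foldr_append)

lemma refl_in_range: "b \<in> roots \<Longrightarrow> refl b \<in> range word_map"
  by (metis refl_root_word rangeI)

lemma conj_refl_word_map: "word_map u \<circ> refl b \<circ> word_map (rev u) = refl (word_map u b)"
  using refl_word_map[of u b "word_map (rev u) _"] by (simp add: fun_eq_iff)

lemma inv_word_map: "inv\<^bsub>linear_group\<^esub> (word_map u) = word_map (rev u)"
proof -
  interpret L: group linear_group by (rule group_linear_group)
  show ?thesis by (rule L.inv_equality) (auto simp: fun_eq_iff)
qed

lemma inv_refl: "b \<in> roots \<Longrightarrow> inv\<^bsub>linear_group\<^esub> (refl b) = refl b"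
proof -
  interpret L: group linear_group by (rule group_linear_group)
  show "b \<in> roots \<Longrightarrow> ?thesis" by (rule L.inv_equality) (auto simp: refl_comp_refl refl_in_range)
qed

lemma conjugation_closed_linear: "conjugation_closed linear_group linear_reflections"
proof -
  interpret L: group linear_group by (rule group_linear_group)
  show ?thesis
  proof
    show "linear_reflections \<subseteq> carrier linear_group"
      by (auto simp: linear_reflections_def refl_in_range)
    fix g t assume "g \<in> carrier linear_group" "t \<in> linear_reflections"
    then show "g \<otimes>\<^bsub>linear_group\<^esub> t \<otimes>\<^bsub>linear_group\<^esub> inv\<^bsub>linear_group\<^esub> g \<in> linear_reflections"
      by (auto simp: linear_reflections_def inv_word_map conj_refl_word_map word_map_in_roots
          simp del: foldr_append)
  qed
qed

interpretation L: conjugation_closed linear_group linear_reflections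
  by (rule conjugation_closed_linear)

abbreviation equiv_L (infix "\<leadsto>" 50) where "ts \<leadsto> us \<equiv> hurwitz_equiv linear_group ts us"
abbreviation prod_L where "prod_L ts \<equiv> group_prod linear_group ts"
abbreviation simple_word :: "'n list \<Rightarrow> (real ^ 'n \<Rightarrow> real ^ 'n) list" where
  "simple_word u \<equiv> map (simple_reflection E) u"

lemma refl_in_linear_reflections: "b \<in> roots \<Longrightarrow> refl b \<in> linear_reflections"
  by (simp add: linear_reflections_def)

lemma simple_word_linear_reflections: "set (simple_word u) \<subseteq> linear_reflections"
  by (auto simp: simple_reflection_eq_reflect refl_in_linear_reflections simple_root_in_roots)

lemma linear_reflections_involution:
  "t \<in> linear_reflections \<Longrightarrow> t \<circ> t = id" "t \<in> linear_reflections \<Longrightarrow> inv\<^bsub>linear_group\<^esub> t = t"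
  by (auto simp: linear_reflections_def refl_comp_refl inv_refl)

lemma linear_reflections_subset: "linear_reflections \<subseteq> range word_map"
  using L.T_carrier by simp

lemma equiv_swap_right:
  "g \<in> linear_reflections \<Longrightarrow> xs @ f # g # ys \<leadsto> xs @ g # (g \<circ> f \<circ> g) # ys"
  using hurwitz_equiv_right[of linear_group xs f g ys] by (simp add: linear_reflections_involution)

lemma equiv_swap_left:
  "f \<in> linear_reflections \<Longrightarrow> xs @ f # g # ys \<leadsto> xs @ (f \<circ> g \<circ> f) # f # ys"
  using hurwitz_equiv_left[of linear_group xs f g ys] by (simp add: linear_reflections_involution)

lemma conj_linear_reflections:
  assumes "f \<in> linear_reflections" "g \<in> linear_reflections"
  shows "f \<circ> g \<circ> f \<in> linear_reflections" "f \<circ> (f \<circ> g \<circ> f) \<circ> f = g"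
proof -
  show "f \<circ> g \<circ> f \<in> linear_reflections"
    using L.conj_closed[of f g] assms linear_reflections_subset
    by (auto simp: linear_reflections_involution)
  have "f (f x) = x" for x
    using linear_reflections_involution(1)[OF assms(1)] by (simp add: fun_eq_iff)
  then show "f \<circ> (f \<circ> g \<circ> f) \<circ> f = g" by (simp add: fun_eq_iff)
qed

text \<open>A cancelling pair is transparent: each copy of t conjugates the passed entry once, and
  the two conjugations undo each other.\<close>

lemma pair_move_right:
  assumes "t \<in> linear_reflections" "set ys \<subseteq> linear_reflections"
  shows "xs @ t # t # ys \<leadsto> xs @ ys @ [t, t]"
  using assms(2)
proof (induction ys arbitrary: xs)
  case Nil
  then show ?case by (simp add: hurwitz_equiv_refl)
next
  case (Cons y ys)
  have "xs @ t # t # y # ys \<leadsto> xs @ t # (t \<circ> y \<circ> t) # t # ys"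
    using equiv_swap_left[OF assms(1), of "xs @ [t]" y ys] by simp
  also have "\<dots> \<leadsto> xs @ y # t # t # ys"
    using equiv_swap_left[OF assms(1), of xs "t \<circ> y \<circ> t"] conj_linear_reflections(2) assms(1) Cons.prems
    by simp
  also have "\<dots> \<leadsto> xs @ (y # ys) @ [t, t]"
    using Cons.IH[of "xs @ [y]"] Cons.prems by simp
  finally show ?case .
qed

lemma pair_move_left:
  assumes "t \<in> linear_reflections" "set ys \<subseteq> linear_reflections"
  shows "xs @ ys @ t # t # zs \<leadsto> xs @ t # t # ys @ zs"
  using assms(2)
proof (induction ys arbitrary: zs rule: rev_induct)
  case Nil
  then show ?case by (simp add: hurwitz_equiv_refl)
next
  case (snoc y ys)
  have "xs @ (ys @ [y]) @ t # t # zs \<leadsto> (xs @ ys) @ t # (t \<circ> y \<circ> t) # t # zs"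
    using equiv_swap_right[OF assms(1), of "xs @ ys" y "t # zs"] by simp
  also have "\<dots> \<leadsto> xs @ ys @ t # t # y # zs"
    using equiv_swap_right[OF assms(1), of "xs @ ys @ [t]" "t \<circ> y \<circ> t" zs]
      conj_linear_reflections(2) assms(1) snoc.prems by simp
  also have "\<dots> \<leadsto> xs @ t # t # (ys @ [y]) @ zs"
    using snoc.IH[of "y # zs"] snoc.prems by simp
  finally show ?case .
qed

section \<open>Ascending paths and the removal of peaks\<close>

fun ascending :: "(real ^ 'n \<Rightarrow> real ^ 'n) \<Rightarrow> (real ^ 'n \<Rightarrow> real ^ 'n) list \<Rightarrow> bool" where
  "ascending f [] \<longleftrightarrow> True"
| "ascending f (r # rs) \<longleftrightarrow> map_len f < map_len (f \<circ> r) \<and> ascending (f \<circ> r) rs"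

text \<open>A Hurwitz move at two neighbours changes only the partial product between them, so the
  sum drops exactly when that one vertex is lowered.\<close>

fun path_weight :: "(real ^ 'n \<Rightarrow> real ^ 'n) \<Rightarrow> (real ^ 'n \<Rightarrow> real ^ 'n) list \<Rightarrow> nat" where
  "path_weight f [] = 0"
| "path_weight f (r # rs) = map_len (f \<circ> r) + path_weight (f \<circ> r) rs"

lemma ascending_append: "ascending f (xs @ ys) \<longleftrightarrow> ascending f xs \<and> ascending (f \<circ> prod_L xs) ys"
  by (induction xs arbitrary: f) (auto simp: comp_assoc)

lemma path_weight_append: "path_weight f (xs @ ys) = path_weight f xs + path_weight (f \<circ> prod_L xs) ys"
  by (induction xs arbitrary: f) (auto simp: comp_assoc)

lemma linear_reflection_root:
  assumes "t \<in> linear_reflections"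
  obtains b where "b \<in> roots" "nonneg b" "t = refl b"
proof -
  obtain b where b: "b \<in> roots" "t = refl b" using assms by (auto simp: linear_reflections_def)
  then have "t = refl (- b)" by (simp add: reflect_uminus)
  then show thesis using that b root_nonneg_or_nonpos uminus_in_roots by metis
qed

lemma range_word_map_linear_reflection:
  "\<lbrakk>f \<in> range word_map; t \<in> linear_reflections\<rbrakk> \<Longrightarrow> f \<circ> t \<in> range word_map"
  by (metis linear_reflection_root range_word_map_refl)

text \<open>The alternative of an initial descent serves the induction, where the start
  \<open>f\<close> varies. At the identity, of length 0, it cannot occur.\<close>

lemma peak_exists:
  assumes "f \<in> range word_map" "set rs \<subseteq> linear_reflections" "\<not> ascending f rs"
  shows "(\<exists>r ys. rs = r # ys \<and> map_len (f \<circ> r) < map_len f) \<or>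
    (\<exists>xs a b ys. rs = xs @ a # b # ys \<and> map_len (f \<circ> prod_L xs) < map_len (f \<circ> prod_L xs \<circ> a) \<and>
      map_len (f \<circ> prod_L xs \<circ> a \<circ> b) < map_len (f \<circ> prod_L xs \<circ> a))"
  using assms
proof (induction rs arbitrary: f)
  case (Cons r rs)
  obtain c where "c \<in> roots" "nonneg c" "r = refl c"
    using Cons.prems linear_reflection_root[of r] by auto
  then have "map_len (f \<circ> r) < map_len f \<or> map_len f < map_len (f \<circ> r)"
    using map_len_refl_cases Cons.prems(1) by blast
  then consider "map_len (f \<circ> r) < map_len f" | (up) "map_len f < map_len (f \<circ> r)" by blast
  then show ?case
  proof cases
    case up
    have fr: "f \<circ> r \<in> range word_map"
      using range_word_map_linear_reflection Cons.prems by simp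
    consider (first) b ys where "rs = b # ys" "map_len (f \<circ> r \<circ> b) < map_len (f \<circ> r)"
      | (later) xs a b ys where "rs = xs @ a # b # ys"
        "map_len (f \<circ> r \<circ> prod_L xs) < map_len (f \<circ> r \<circ> prod_L xs \<circ> a)"
        "map_len (f \<circ> r \<circ> prod_L xs \<circ> a \<circ> b) < map_len (f \<circ> r \<circ> prod_L xs \<circ> a)"
    proof -
      have "set rs \<subseteq> linear_reflections" "\<not> ascending (f \<circ> r) rs"
        using Cons.prems up by auto
      from Cons.IH[OF fr this] show thesis using that by blast
    qed
    then show ?thesis
    proof cases
      case first
      then have "r # rs = [] @ r # b # ys" by simp
      then show ?thesis using first(2) up by (metis comp_id group_prod_simps(1) linear_group_simps(3))
    next
      case later
      have "r # rs = (r # xs) @ a # b # ys" using later by simp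
      moreover have "f \<circ> prod_L (r # xs) = f \<circ> r \<circ> prod_L xs" by (simp add: comp_assoc)
      ultimately show ?thesis using later(2,3) by metis
    qed
  qed blast
qed simp

lemma map_len_id: "map_len id = 0"
proof -
  have "id = word_map []" by (simp add: fun_eq_iff)
  then show ?thesis using word_length_le[of word_map "[]"] by simp
qed

lemma set_prod_L_range: "set xs \<subseteq> linear_reflections \<Longrightarrow> prod_L xs \<in> range word_map"
  using L.group_prod_closed[of xs] linear_reflections_subset by (simp add: subset_trans)

lemma equiv_linear_reflections:
  "\<lbrakk>ts \<leadsto> us; set ts \<subseteq> linear_reflections\<rbrakk> \<Longrightarrow> set us \<subseteq> linear_reflections"
  "\<lbrakk>ts \<leadsto> us; set ts \<subseteq> linear_reflections\<rbrakk> \<Longrightarrow> prod_L us = prod_L ts"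
  using L.hurwitz_equiv_factorizations[of ts us "length ts" "prod_L ts"] by (auto simp: factorizations_def)

lemma equiv_ascending_or_pair:
  assumes "set rs \<subseteq> linear_reflections"
  shows "\<exists>us. rs \<leadsto> us \<and> (ascending id us \<or> (\<exists>xs t ys. us = xs @ t # t # ys))"
  using assms
proof (induction "path_weight id rs" arbitrary: rs rule: less_induct)
  case less
  show ?case
  proof (cases "ascending id rs")
    case True
    then show ?thesis using hurwitz_equiv_refl by blast
  next
    case False
    have "id \<in> range word_map" using L.one_closed by simp
    then obtain xs a b ys where rs: "rs = xs @ a # b # ys"
      and up: "map_len (prod_L xs) < map_len (prod_L xs \<circ> a)"
      and down: "map_len (prod_L xs \<circ> a \<circ> b) < map_len (prod_L xs \<circ> a)"
      using peak_exists[of id rs] less.prems False map_len_id by auto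
    have mem: "set xs \<subseteq> linear_reflections" "a \<in> linear_reflections" "b \<in> linear_reflections"
      using less.prems rs by auto
    show ?thesis
    proof (cases "a = b")
      case True
      then show ?thesis using rs hurwitz_equiv_refl by blast
    next
      case False
      obtain p where p: "p \<in> roots" "nonneg p" "a = refl p" using mem(2) by (rule linear_reflection_root)
      obtain q where q: "q \<in> roots" "nonneg q" "b = refl q" using mem(3) by (rule linear_reflection_root)
      define F where "F = prod_L xs"
      define m where "m = F \<circ> a"
      have m: "m \<in> range word_map"
        unfolding m_def F_def using mem by (intro range_word_map_linear_reflection set_prod_L_range)
      have invol: "a (a x) = x" "b (b x) = x" for x
        using linear_reflections_involution(1) mem by (simp_all add: fun_eq_iff)
      have ma: "m \<circ> a = F" by (simp add: m_def fun_eq_iff invol)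
      have "p \<in> inversions m" "q \<in> inversions m"
        using map_len_refl_cases[OF p(1,2) m] map_len_refl_cases[OF q(1,2) m] up down p q ma
        by (auto simp: inversions_def m_def F_def)
      \<comment> \<open>The two composites are the vertices that replace the peak \<open>m\<close>
        after the right and the left Hurwitz move.\<close>
      then consider (right) "map_len (m \<circ> a \<circ> b) < map_len m" | (left) "map_len (m \<circ> b \<circ> a) < map_len m"
        using peak_reduction[OF m] False p(3) q(3) by blast
      then have "\<exists>us. rs \<leadsto> us \<and> path_weight id us < path_weight id rs"
      proof cases
        case right
        have "F \<circ> b \<circ> (b \<circ> a \<circ> b) = F \<circ> a \<circ> b" by (simp add: fun_eq_iff invol)
        then have "path_weight id (xs @ b # (b \<circ> a \<circ> b) # ys) < path_weight id rs"
          using right by (simp add: path_weight_append rs ma flip: F_def) (simp add: m_def)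
        then show ?thesis using equiv_swap_right[OF mem(3)] rs by blast
      next
        case left
        have "F \<circ> (a \<circ> b \<circ> a) \<circ> a = F \<circ> a \<circ> b" by (simp add: fun_eq_iff invol)
        moreover have "F \<circ> (a \<circ> b \<circ> a) = m \<circ> b \<circ> a" by (simp add: m_def comp_assoc)
        ultimately have "path_weight id (xs @ (a \<circ> b \<circ> a) # a # ys) < path_weight id rs"
          using left by (simp add: path_weight_append rs flip: F_def) (simp add: m_def)
        then show ?thesis using equiv_swap_left[OF mem(2)] rs by blast
      qed
      then show ?thesis
        using less.hyps less.prems equiv_linear_reflections(1) hurwitz_equiv_trans by metis
    qed
  qed
qed

section \<open>Normal form: an ascending part followed by cancelling pairs\<close>

definition doubled :: "'a list \<Rightarrow> 'a list" where
  "doubled ts = concat (map (\<lambda>t. [t, t]) ts)"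

text \<open>A pair parked at the end leaves a shorter tuple, to which the peak argument applies
  anew; its later moves do not disturb the parked pair.\<close>

lemma equiv_ascending_pairs:
  assumes "set rs \<subseteq> linear_reflections"
  shows "\<exists>us ts. rs \<leadsto> us @ doubled ts \<and> ascending id us \<and> set us \<subseteq> linear_reflections \<and>
    set ts \<subseteq> linear_reflections"
  using assms
proof (induction "length rs" arbitrary: rs rule: less_induct)
  case less
  obtain vs where vs: "rs \<leadsto> vs" and "ascending id vs \<or> (\<exists>xs t ys. vs = xs @ t # t # ys)"
    using equiv_ascending_or_pair[OF less.prems] by blast
  have vs_refl: "set vs \<subseteq> linear_reflections"
    using equiv_linear_reflections(1)[OF vs less.prems] .
  from \<open>ascending id vs \<or> _\<close> consider "ascending id vs" | (pair) xs t ys where "vs = xs @ t # t # ys"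
    by blast
  then show ?case
  proof cases
    case 1
    then have "rs \<leadsto> vs @ doubled []" using vs by (simp add: doubled_def)
    then show ?thesis using 1 vs_refl by (metis empty_set empty_subsetI)
  next
    case pair
    have mem: "t \<in> linear_reflections" "set ys \<subseteq> linear_reflections" "set (xs @ ys) \<subseteq> linear_reflections"
      using vs_refl pair by auto
    have "rs \<leadsto> (xs @ ys) @ [t, t]"
      using hurwitz_equiv_trans[OF vs] pair_move_right[OF mem(1,2), of xs] pair by simp
    moreover have "length (xs @ ys) < length rs"
      using hurwitz_equiv_length[OF vs] pair by simp
    then obtain us ts where ind: "xs @ ys \<leadsto> us @ doubled ts" "ascending id us"
      "set us \<subseteq> linear_reflections" "set ts \<subseteq> linear_reflections"
      using less.hyps[of "xs @ ys"] mem by blast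
    ultimately have "rs \<leadsto> us @ doubled (ts @ [t])"
      using hurwitz_equiv_append[OF ind(1), of "[t, t]"] hurwitz_equiv_trans by (simp add: doubled_def) blast
    moreover have "set (ts @ [t]) \<subseteq> linear_reflections" using ind mem by simp
    ultimately show ?thesis using ind by blast
  qed
qed

lemma equiv_move_through_simple_word:
  assumes "b \<in> roots"
  shows "xs @ simple_word u @ refl b # ys \<leadsto> xs @ refl (word_map u b) # simple_word u @ ys"
  using assms
proof (induction u arbitrary: b ys rule: rev_induct)
  case Nil
  then show ?case by (simp add: hurwitz_equiv_refl)
next
  case (snoc i u)
  let ?b = "simple_reflection E i b"
  have "simple_reflection E i \<in> linear_reflections"
    by (simp add: simple_reflection_eq_reflect refl_in_linear_reflections simple_root_in_roots)
  moreover have "simple_reflection E i \<circ> refl b \<circ> simple_reflection E i = refl ?b"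
    using conj_refl_word_map[of "[i]" b] by simp
  ultimately have "xs @ simple_word (u @ [i]) @ refl b # ys
      \<leadsto> xs @ simple_word u @ refl ?b # simple_reflection E i # ys"
    using equiv_swap_left[of "simple_reflection E i" "xs @ simple_word u" "refl b" ys] by simp
  also have "\<dots> \<leadsto> xs @ refl (word_map u ?b) # simple_word u @ simple_reflection E i # ys"
    using snoc.prems word_map_in_roots[of b "[i]"] by (intro snoc.IH) simp
  finally show ?case by simp
qed

text \<open>The last letter t negates \<open>\<alpha> t\<close>, and the letters before it leave
  coordinate t alone; so that coordinate ends as -1.\<close>

lemma distinct_word_map_id:
  assumes "distinct u" "word_map u = id"
  shows "u = []"
proof (cases u rule: rev_cases)
  case (snoc x t)
  have "word_map u (\<alpha> t) $ t = - word_map x (\<alpha> t) $ t"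
    by (simp add: snoc simple_reflection_simple word_map_simps)
  also have "word_map x (\<alpha> t) $ t = 1"
    using assms(1) snoc by (simp add: word_map_nth simple_root_nth)
  finally show ?thesis using assms(2) by (simp add: simple_root_nth)
qed

text \<open>An ascent at the last factor makes its root an inversion of u, so exchange deletes a
  letter i from u and gives the product of the other factors. They are reordered by induction, and
  moving the last factor left through the letters after the gap turns it into the missing reflection
  i.\<close>

lemma equiv_simple_word_if_ascending:
  assumes "ascending id rs" "set rs \<subseteq> linear_reflections" "prod_L rs = word_map u" "distinct u"
  shows "length rs = length u \<and> rs \<leadsto> simple_word u"
  using assms
proof (induction rs arbitrary: u rule: rev_induct)
  case Nil
  then have "word_map u = id" by (simp only: group_prod_simps linear_group_simps)
  then have "u = []" using Nil.prems(4) distinct_word_map_id by blast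
  then show ?case by (simp add: hurwitz_equiv_refl)
next
  case (snoc r rs)
  have rs: "ascending id rs" "set rs \<subseteq> linear_reflections" "r \<in> linear_reflections"
    and up: "map_len (prod_L rs) < map_len (prod_L rs \<circ> r)"
    using snoc.prems(1,2) unfolding ascending_append ascending.simps id_comp set_append by simp_all
  obtain b where b: "b \<in> roots" "nonneg b" "r = refl b" using rs(3) by (rule linear_reflection_root)
  have "prod_L (rs @ [r]) = prod_L rs \<circ> r"
    using rs linear_reflections_subset by (subst L.group_prod_append) auto
  then have u: "word_map u = prod_L rs \<circ> r" using snoc.prems(3) by simp
  then have prod: "prod_L rs = word_map u \<circ> refl b"
    using linear_reflections_involution(1)[OF rs(3)] b(3) by (simp add: comp_assoc)
  have "map_len (word_map u \<circ> refl b) < map_len (word_map u)"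
  proof -
    have "map_len (prod_L rs) < map_len (word_map u)" using up by (simp only: u)
    then show ?thesis unfolding prod .
  qed
  then have "nonneg (- word_map u b)"
    using map_len_refl_cases[OF b(1,2) rangeI, of u] by linarith
  then obtain x i y where xy: "u = x @ i # y" "word_map y b = \<alpha> i"
    using exchange b by blast
  then have "prod_L rs = word_map (x @ y)"
    using prod exchange_word_map by metis
  then have IH: "length rs = length (x @ y)" "rs \<leadsto> simple_word (x @ y)"
    using snoc.IH[OF rs(1,2), of "x @ y"] snoc.prems(4) xy(1) by auto
  have "rs @ [r] \<leadsto> simple_word x @ simple_word y @ [refl b]"
    using hurwitz_equiv_append[OF IH(2), of "[r]"] b by simp
  also have "\<dots> \<leadsto> simple_word u"
    using equiv_move_through_simple_word[OF b(1), of "simple_word x" y "[]"] xy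
    by (simp add: simple_reflection_eq_reflect)
  finally show ?case using IH xy by simp
qed

lemma prod_L_append:
  "\<lbrakk>set xs \<subseteq> linear_reflections; set ys \<subseteq> linear_reflections\<rbrakk> \<Longrightarrow> prod_L (xs @ ys) = prod_L xs \<circ> prod_L ys"
  using linear_reflections_subset by (subst L.group_prod_append) auto

lemma prod_L_doubled: "set ts \<subseteq> linear_reflections \<Longrightarrow> prod_L (doubled ts) = id"
proof (induction ts)
  case (Cons t ts)
  then have "t (t x) = x" for x
    using linear_reflections_involution(1)[of t] by (simp add: fun_eq_iff)
  with Cons show ?case by (simp add: doubled_def fun_eq_iff)
qed (simp add: doubled_def)

text \<open>Pairs multiply to the identity, so the ascending part has the product and hence the
  length of u. The two surplus factors form one pair.\<close>

lemma equiv_simple_word_pair: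
  assumes "set rs \<subseteq> linear_reflections" "prod_L rs = word_map u" "distinct u" "length rs = length u + 2"
  obtains b where "b \<in> roots" "rs \<leadsto> simple_word u @ [refl b, refl b]"
proof -
  obtain us ts where equiv: "rs \<leadsto> us @ doubled ts" and us: "ascending id us"
    "set us \<subseteq> linear_reflections" and ts: "set ts \<subseteq> linear_reflections"
    using equiv_ascending_pairs[OF assms(1)] by blast
  have "set (doubled ts) \<subseteq> linear_reflections" using ts by (auto simp: doubled_def)
  then have "prod_L us = word_map u"
    using equiv_linear_reflections(2)[OF equiv assms(1)] us ts assms(2)
    by (simp add: prod_L_append prod_L_doubled)
  then have simple: "length us = length u" "us \<leadsto> simple_word u"
    using equiv_simple_word_if_ascending[OF us] assms(3) by auto
  have "length (doubled ts) = 2 * length ts" by (induction ts) (auto simp: doubled_def)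
  then have "length ts = 1"
    using hurwitz_equiv_length[OF equiv] simple(1) assms(4) by simp
  then obtain t where t: "ts = [t]" by (auto simp: length_Suc_conv)
  obtain b where "b \<in> roots" "t = refl b" using ts t linear_reflection_root[of t] by auto
  moreover have "rs \<leadsto> simple_word u @ [t, t]"
    using hurwitz_equiv_trans[OF equiv hurwitz_equiv_append[OF simple(2)]] t by (simp add: doubled_def)
  ultimately show thesis using that by blast
qed

section \<open>Conjugating the remaining pair to the root at z\<close>

text \<open>Expand the norm 2 of \<open>b\<close> in coordinates. If no index other than z
  contributes positively, the form with \<open>\<alpha> z\<close> is at least 2, so reflecting at z
  makes coordinate z negative. Only \<open>\<alpha> z\<close> itself changes sign under that
  reflection.\<close>

lemma root_coefficient_one_descent:
  assumes b: "b \<in> roots" "b $ z = 1" "b \<noteq> \<alpha> z"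
  shows "\<exists>i. i \<noteq> z \<and> 0 < form (\<alpha> i) b"
proof (rule ccontr)
  assume neg: "\<nexists>i. i \<noteq> z \<and> 0 < form (\<alpha> i) b"
  have pos: "nonneg b"
    using root_nonneg_or_nonpos[OF b(1)] b(2) by (auto simp: nonneg_def dest: spec[of _ z])
  have "2 = b $ z * form (\<alpha> z) b + (\<Sum>i\<in>UNIV - {z}. b $ i * form (\<alpha> i) b)"
    using root_form_expand[of E b b] b(1) by (simp add: sum.remove[of UNIV z])
  also have "(\<Sum>i\<in>UNIV - {z}. b $ i * form (\<alpha> i) b) \<le> 0"
    using neg pos by (intro sum_nonpos mult_nonneg_nonpos) (auto simp: nonneg_def not_less)
  finally have "2 \<le> form (\<alpha> z) b" using b(2) by simp
  then have "simple_reflection E z b $ z < 0"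
    using b(2) by (simp add: simple_reflection_def simple_root_nth)
  then have "\<not> nonneg (simple_reflection E z b)" by (auto simp: nonneg_def not_le)
  then have "nonneg (- simple_reflection E z b)"
    using root_nonneg_or_nonpos word_map_in_roots[OF b(1), of "[z]"] by auto
  then have "b = \<alpha> z"
    using b(1) pos by (intro root_eq_simple_if_reflected_nonpos)
  then show False using b(3) by simp
qed

text \<open>Park the pair just after the letter i, move i past both copies, which conjugates each of
  them, and send the pair back to the end.\<close>

lemma equiv_conj_pair:
  assumes "b \<in> roots" "i \<in> set u"
  shows "simple_word u @ [refl b, refl b]
    \<leadsto> simple_word u @ [refl (simple_reflection E i b), refl (simple_reflection E i b)]"
proof -
  let ?s = "simple_reflection E i" and ?b = "simple_reflection E i b"
  obtain x y where u: "u = x @ i # y" using assms(2) by (meson split_list)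
  have s: "?s \<in> linear_reflections" using simple_word_linear_reflections[of "[i]"] by simp
  have t: "refl b \<in> linear_reflections" "refl ?b \<in> linear_reflections"
    using assms(1) word_map_in_roots[of b "[i]"] by (auto intro: refl_in_linear_reflections)
  have conj: "?s \<circ> refl b \<circ> ?s = refl ?b"
    using conj_refl_word_map[of "[i]" b] by simp
  have "simple_word u @ [refl b, refl b] \<leadsto> simple_word x @ ?s # refl b # refl b # simple_word y"
    using pair_move_left[OF t(1) simple_word_linear_reflections, of "simple_word x @ [?s]" y "[]"] u by simp
  also have "\<dots> \<leadsto> simple_word x @ refl ?b # ?s # refl b # simple_word y"
    using equiv_swap_left[OF s, of "simple_word x" "refl b"] conj by simp
  also have "\<dots> \<leadsto> simple_word x @ refl ?b # refl ?b # ?s # simple_word y"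
    using equiv_swap_left[OF s, of "simple_word x @ [refl ?b]" "refl b"] conj by simp
  also have "\<dots> \<leadsto> simple_word u @ [refl ?b, refl ?b]"
    using pair_move_right[OF t(2) simple_word_linear_reflections, of "simple_word x" "i # y"] u by simp
  finally show ?thesis .
qed

lemma equiv_simple_pair:
  assumes "b \<in> roots" "b $ z = 1" "UNIV - {z} \<subseteq> set u"
  shows "simple_word u @ [refl b, refl b] \<leadsto> simple_word u @ [refl (\<alpha> z), refl (\<alpha> z)]"
  using assms(1,2)
\<comment> \<open>The measure is the height of the root. Reflecting at i lowers it by a positive
  integer, and as i differs from z the coefficient 1 at z persists and keeps the root
  nonnegative.\<close>
proof (induction "nat \<lfloor>\<Sum>i\<in>UNIV. b $ i\<rfloor>" arbitrary: b rule: less_induct)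
  case less
  show ?case
  proof (cases "b = \<alpha> z")
    case True
    then show ?thesis by (simp add: hurwitz_equiv_refl)
  next
    case False
    obtain i where i: "i \<noteq> z" "0 < form (\<alpha> i) b"
      using root_coefficient_one_descent less.prems False by blast
    let ?b = "simple_reflection E i b"
    have root: "?b \<in> roots" using word_map_in_roots[OF less.prems(1), of "[i]"] by simp
    have bz: "?b $ z = 1" using less.prems(2) i(1) by (simp add: simple_reflection_nth)
    have nonneg: "nonneg ?b"
      using root_nonneg_or_nonpos[OF root] bz by (auto simp: nonneg_def dest: spec[of _ z])
    obtain k :: int where k: "form (\<alpha> i) b = of_int k"
      using integral_root_form integral_root simple_root_in_roots less.prems(1) by (metis Ints_cases)
    then have "1 \<le> form (\<alpha> i) b" using i(2) by simp
    moreover have "(\<Sum>j\<in>UNIV. ?b $ j) = (\<Sum>j\<in>UNIV. b $ j) - form (\<alpha> i) b"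
      by (simp add: simple_reflection_def simple_root_nth sum_subtractf flip: sum_distrib_left)
    moreover have "0 \<le> (\<Sum>j\<in>UNIV. ?b $ j)"
      using nonneg by (simp add: nonneg_def sum_nonneg)
    ultimately have "nat \<lfloor>\<Sum>j\<in>UNIV. ?b $ j\<rfloor> < nat \<lfloor>\<Sum>j\<in>UNIV. b $ j\<rfloor>"
      by linarith
    then have "simple_word u @ [refl ?b, refl ?b] \<leadsto> simple_word u @ [refl (\<alpha> z), refl (\<alpha> z)]"
      using root bz by (rule less.hyps)
    moreover have "i \<in> set u" using assms(3) i(1) by auto
    ultimately show ?thesis
      using equiv_conj_pair[OF less.prems(1)] hurwitz_equiv_trans by blast
  qed
qed


section \<open>The extended Coxeter group\<close>

abbreviation rep :: "'w \<Rightarrow> real ^ 'n \<Rightarrow> real ^ 'n" where "rep \<equiv> geometric_rep W s E"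
abbreviation lattice :: "(real ^ 'n) set" where "lattice \<equiv> root_lattice W s E"
abbreviation ext_group :: "('w \<times> (real ^ 'n)) monoid" ("\<G>") where "\<G> \<equiv> extended_group W s E"

text \<open>\<open>geometric_rep\<close> evaluates some word for the element;
  \<open>s_represent\<close> makes that choice harmless.\<close>

lemma rep_word_prod [simp]: "rep (word_prod u) = word_map u"
  unfolding geometric_rep_def by (rule s_represent) (rule someI, rule HOL.refl)

lemma carrier_word_prod:
  assumes "w \<in> carrier W"
  obtains u where "w = word_prod u"
  using s_generate[OF assms] by blast

lemma rep_one: "rep \<one> x = x"
  using rep_word_prod[of "[]"] by simp

lemma rep_s [simp]: "rep (s i) = simple_reflection E i"
  using rep_word_prod[of "[i]"] by simp

lemma rep_mult: "\<lbrakk>v \<in> carrier W; w \<in> carrier W\<rbrakk> \<Longrightarrow> rep (v \<otimes> w) x = rep v (rep w x)"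
  by (elim carrier_word_prod) (simp flip: word_prod_append del: map_append)

lemma rep_inv [simp]:
  assumes "w \<in> carrier W"
  shows "rep (inv w) (rep w x) = x" "rep w (rep (inv w) x) = x"
  using assms by (simp_all add: rep_one flip: rep_mult)

lemma rep_in_range: "w \<in> carrier W \<Longrightarrow> rep w \<in> range word_map"
  by (elim carrier_word_prod) simp

lemma rep_inj:
  assumes "v \<in> carrier W" "w \<in> carrier W" "rep v = rep w"
  shows "v = w"
  using assms word_prod_eq_iff by (elim carrier_word_prod) simp

lemma rep_linear:
  assumes "w \<in> carrier W"
  shows "rep w (x + y) = rep w x + rep w y" "rep w (x - y) = rep w x - rep w y"
    "rep w (- x) = - rep w x" "rep w (a *\<^sub>R x) = a *\<^sub>R rep w x" "rep w 0 = 0"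
  using assms by (elim carrier_word_prod; simp add: word_map_simps linear_0[OF word_map_linear])+

lemma form_rep: "w \<in> carrier W \<Longrightarrow> form (rep w x) (rep w y) = form x y"
  by (elim carrier_word_prod) (simp add: form_word_map)

lemma root_system_eq: "root_system W s E = roots"
proof
  show "root_system W s E \<subseteq> roots"
  proof
    fix b assume "b \<in> root_system W s E"
    then obtain w i where "b = rep w (\<alpha> i)" "w \<in> carrier W" by (auto simp: root_system_def)
    then obtain u where "b = word_map u (\<alpha> i)" by (metis carrier_word_prod rep_word_prod)
    then show "b \<in> roots" unfolding roots_def by blast
  qed
  show "roots \<subseteq> root_system W s E"
  proof
    fix b assume "b \<in> roots"
    then obtain u i where "b = rep (word_prod u) (\<alpha> i)" by (auto simp: roots_def)
    then show "b \<in> root_system W s E" unfolding root_system_def using word_prod_closed by blast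
  qed
qed

interpretation int_module: module "\<lambda>(k::int) (v :: real ^ 'n). of_int k *\<^sub>R v"
  by unfold_locales (auto simp: algebra_simps)

lemma lattice_eq: "lattice = int_module.span roots"
  by (simp add: root_lattice_def root_system_eq)

lemma lattice_closed [simp]:
  "0 \<in> lattice" "\<lbrakk>x \<in> lattice; y \<in> lattice\<rbrakk> \<Longrightarrow> x + y \<in> lattice"
  "x \<in> lattice \<Longrightarrow> - x \<in> lattice" "x \<in> lattice \<Longrightarrow> of_int k *\<^sub>R x \<in> lattice"
  unfolding lattice_eq
  by (auto intro: int_module.span_zero int_module.span_add int_module.span_neg int_module.span_scale)

lemma root_in_lattice: "b \<in> roots \<Longrightarrow> b \<in> lattice"
  unfolding lattice_eq by (rule int_module.span_base)

lemma rep_lattice [simp]: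
  assumes "w \<in> carrier W" "x \<in> lattice"
  shows "rep w x \<in> lattice"
  using assms(2) unfolding lattice_eq
proof (induction rule: int_module.span_induct)
  case base
  show ?case
    unfolding int_module.subspace_def using assms(1) lattice_closed(1,2,4)
    by (simp add: rep_linear flip: lattice_eq)
next
  case (step x)
  then show ?case
    using assms(1) by (elim carrier_word_prod) (simp add: int_module.span_base word_map_in_roots)
qed

lemma integral_lattice: "x \<in> lattice \<Longrightarrow> integral_vec x"
  unfolding lattice_eq
proof (induction rule: int_module.span_induct)
  case base
  then show ?case unfolding int_module.subspace_def by (simp add: integral_vec_def)
next
  case (step x)
  then show ?case by (rule integral_root)
qed

lemma ext_group_simps:
  "carrier \<G> = carrier W \<times> lattice" "\<one>\<^bsub>\<G>\<^esub> = (\<one>, 0)"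
  "g \<otimes>\<^bsub>\<G>\<^esub> h = (fst g \<otimes> fst h, rep (inv (fst h)) (snd g) + snd h)"
  by (auto simp: extended_group_def split: prod.splits)

lemma group_ext_group: "group \<G>"
proof (rule groupI)
  fix g assume "g \<in> carrier \<G>"
  then have "(inv (fst g), - rep (fst g) (snd g)) \<in> carrier \<G>"
    "(inv (fst g), - rep (fst g) (snd g)) \<otimes>\<^bsub>\<G>\<^esub> g = \<one>\<^bsub>\<G>\<^esub>"
    by (auto simp: ext_group_simps rep_linear)
  then show "\<exists>h\<in>carrier \<G>. h \<otimes>\<^bsub>\<G>\<^esub> g = \<one>\<^bsub>\<G>\<^esub>" by blast
qed (auto simp: ext_group_simps m_assoc inv_mult_group rep_mult rep_linear rep_one)

text \<open>The action under which multiplication of pairs is composition. Translating before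
  applying the linear part is dictated by the convention of the semidirect product.\<close>

definition affine_map :: "'w \<times> (real ^ 'n) \<Rightarrow> real ^ 'n \<Rightarrow> real ^ 'n" where
  "affine_map g x = rep (fst g) (x + snd g)"

lemma affine_map_mult:
  "\<lbrakk>g \<in> carrier \<G>; h \<in> carrier \<G>\<rbrakk> \<Longrightarrow> affine_map (g \<otimes>\<^bsub>\<G>\<^esub> h) x = affine_map g (affine_map h x)"
  by (auto simp: affine_map_def ext_group_simps rep_mult rep_linear)

lemma rep_eq_affine_map: "g \<in> carrier \<G> \<Longrightarrow> rep (fst g) x = affine_map g x - affine_map g 0"
  by (auto simp: affine_map_def ext_group_simps rep_linear)

lemma affine_map_inj:
  assumes g: "g \<in> carrier \<G>" and h: "h \<in> carrier \<G>" and eq: "affine_map g = affine_map h"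
  shows "g = h"
proof -
  have "rep (fst g) = rep (fst h)"
    using rep_eq_affine_map g h eq by (simp add: fun_eq_iff)
  then have fst: "fst g = fst h"
    using g h by (intro rep_inj) (auto simp: ext_group_simps)
  have "rep (inv (fst g)) (affine_map g 0) = snd g" "rep (inv (fst h)) (affine_map h 0) = snd h"
    using g h by (auto simp: affine_map_def ext_group_simps)
  then show ?thesis using fst eq by (simp add: prod_eq_iff)
qed

text \<open>For a root \<open>b\<close>, the reflection in the hyperplane where
  \<open>form b x = - k\<close>.\<close>

definition affine_refl :: "real ^ 'n \<Rightarrow> int \<Rightarrow> real ^ 'n \<Rightarrow> real ^ 'n" where
  "affine_refl b k x = refl b x - of_int k *\<^sub>R b"

text \<open>Levels 0 and 1 are generators; the other levels are those that Hurwitz moves on a pair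
  at the same i produce.\<close>

definition translated_refl :: "'n \<Rightarrow> int \<Rightarrow> 'w \<times> (real ^ 'n)" where
  "translated_refl i k = (s i, of_int k *\<^sub>R \<alpha> i)"

lemma translated_refl_eqs:
  "extended_gen s i = translated_refl i 0" "extra_gen s i = translated_refl i 1"
  by (simp_all add: translated_refl_def extended_gen_def extra_gen_def)

lemma translated_refl_closed [simp]: "translated_refl i k \<in> carrier \<G>"
  by (simp add: translated_refl_def ext_group_simps root_in_lattice simple_root_in_roots)

lemma affine_map_translated_refl: "affine_map (translated_refl i k) = affine_refl (\<alpha> i) k"
  by (simp add: fun_eq_iff affine_map_def translated_refl_def affine_refl_def
      simple_reflection_eq_reflect reflect_simps reflect_self)

lemma extended_gens_closed [simp]:
  "extended_gen s i \<in> carrier \<G>" "extra_gen s i \<in> carrier \<G>" "extended_gen s ` A \<subseteq> carrier \<G>"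
  by (auto simp: translated_refl_eqs)

lemma affine_map_extended_gen: "affine_map (extended_gen s i) = simple_reflection E i"
  by (simp add: translated_refl_eqs affine_map_translated_refl)
    (simp add: fun_eq_iff affine_refl_def simple_reflection_eq_reflect)

lemma affine_map_extra_gen: "affine_map (extra_gen s i) = affine_refl (\<alpha> i) 1"
  by (simp add: translated_refl_eqs affine_map_translated_refl)

section \<open>Reflections of the extended group as affine reflections\<close>

abbreviation ext_reflections :: "'n \<Rightarrow> ('w \<times> (real ^ 'n)) set" where
  "ext_reflections z \<equiv> reflections W s E z"

lemma ext_reflections_eq:
  "ext_reflections z = {g \<otimes>\<^bsub>\<G>\<^esub> x \<otimes>\<^bsub>\<G>\<^esub> inv\<^bsub>\<G>\<^esub> g | g x. g \<in> carrier \<G> \<and> x \<in> extended_gens s z}"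
  by (simp add: reflections_def Let_def)

lemma extended_gens_translated_refl:
  assumes "x \<in> extended_gens s z"
  obtains i k where "x = translated_refl i k"
  using assms by (auto simp: extended_gens_def translated_refl_eqs)

lemma conjugation_closed_ext: "conjugation_closed \<G> (ext_reflections z)"
proof -
  interpret G: group \<G> by (rule group_ext_group)
  have gens: "extended_gens s z \<subseteq> carrier \<G>"
    using extended_gens_translated_refl translated_refl_closed by blast
  show ?thesis
  proof
    show "ext_reflections z \<subseteq> carrier \<G>"
      using gens by (auto simp: ext_reflections_eq)
    fix g t assume g: "g \<in> carrier \<G>" and "t \<in> ext_reflections z"
    then obtain h x where t: "t = h \<otimes>\<^bsub>\<G>\<^esub> x \<otimes>\<^bsub>\<G>\<^esub> inv\<^bsub>\<G>\<^esub> h" "h \<in> carrier \<G>" "x \<in> extended_gens s z"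
      by (auto simp: ext_reflections_eq)
    have "x \<in> carrier \<G>" using t(3) gens by blast
    then have "g \<otimes>\<^bsub>\<G>\<^esub> t \<otimes>\<^bsub>\<G>\<^esub> inv\<^bsub>\<G>\<^esub> g = (g \<otimes>\<^bsub>\<G>\<^esub> h) \<otimes>\<^bsub>\<G>\<^esub> x \<otimes>\<^bsub>\<G>\<^esub> inv\<^bsub>\<G>\<^esub> (g \<otimes>\<^bsub>\<G>\<^esub> h)"
      using g t by (simp add: G.m_assoc G.inv_mult_group)
    then show "g \<otimes>\<^bsub>\<G>\<^esub> t \<otimes>\<^bsub>\<G>\<^esub> inv\<^bsub>\<G>\<^esub> g \<in> ext_reflections z"
      unfolding ext_reflections_eq using g t by blast
  qed
qed

text \<open>The linear part of \<open>g\<close> transports the root, and its translation l shifts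
  the level by the form of \<open>\<alpha> i\<close> with l, an integer because l lies in the root
  lattice.\<close>

lemma conj_affine_refl:
  assumes g: "g \<in> carrier \<G>"
  obtains k' where "affine_map (g \<otimes>\<^bsub>\<G>\<^esub> translated_refl i k \<otimes>\<^bsub>\<G>\<^esub> inv\<^bsub>\<G>\<^esub> g)
    = affine_refl (rep (fst g) (\<alpha> i)) k'"
proof -
  interpret G: group \<G> by (rule group_ext_group)
  obtain w l where gw: "g = (w, l)" by fastforce
  have w: "w \<in> carrier W" and l: "l \<in> lattice" using g gw by (auto simp: ext_group_simps)
  obtain m where m: "form (\<alpha> i) l = of_int m"
    using integral_root_form integral_root simple_root_in_roots integral_lattice[OF l] by (metis Ints_cases)
  have "affine_map (g \<otimes>\<^bsub>\<G>\<^esub> translated_refl i k \<otimes>\<^bsub>\<G>\<^esub> inv\<^bsub>\<G>\<^esub> g) x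
      = affine_refl (rep w (\<alpha> i)) (k - m) x" for x
  proof -
    define y where "y = affine_map (inv\<^bsub>\<G>\<^esub> g) x"
    have "affine_map g y = affine_map \<one>\<^bsub>\<G>\<^esub> x"
      unfolding y_def using g by (simp flip: affine_map_mult)
    then have x: "x = rep w y + rep w l"
      using w by (simp add: affine_map_def ext_group_simps rep_one gw rep_linear)
    have "affine_map (g \<otimes>\<^bsub>\<G>\<^esub> translated_refl i k \<otimes>\<^bsub>\<G>\<^esub> inv\<^bsub>\<G>\<^esub> g) x
      = affine_map g (affine_map (translated_refl i k) y)"
      using g by (simp add: affine_map_mult y_def)
    also have "\<dots> = rep w (refl (\<alpha> i) y - of_int k *\<^sub>R \<alpha> i + l)"
      by (simp add: affine_map_translated_refl affine_refl_def) (simp add: affine_map_def gw)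
    also have "\<dots> = affine_refl (rep w (\<alpha> i)) (k - m) x"
      using w by (simp add: x affine_refl_def reflect_def root_form_simps form_rep m rep_linear algebra_simps)
    finally show ?thesis .
  qed
  then show thesis using that gw by fastforce
qed

lemma affine_refl_linear_part:
  assumes "g \<in> carrier \<G>" "affine_map g = affine_refl b k"
  shows "rep (fst g) = refl b"
  using rep_eq_affine_map[OF assms(1)] linear_0[OF linear_reflect[of E b]]
  by (simp add: fun_eq_iff assms(2) affine_refl_def)

lemma refl_eq_iff:
  assumes "a \<in> roots" "b \<in> roots" "refl a = refl b"
  shows "a = b \<or> a = - b"
proof -
  have "refl a b = - b" using assms(2,3) by (simp add: reflect_self)
  then have b: "2 *\<^sub>R b = form a b *\<^sub>R a" by (simp add: reflect_def scaleR_2 algebra_simps)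
  have "form (2 *\<^sub>R b) (2 *\<^sub>R b) = form (form a b *\<^sub>R a) (form a b *\<^sub>R a)" by (simp only: b)
  then have "(form a b)\<^sup>2 = 2\<^sup>2" using assms(1,2) by (simp add: root_form_simps power2_eq_square)
  then have "form a b = 2 \<or> form a b = - 2" by (simp only: power2_eq_iff)
  then show ?thesis
  proof
    assume "form a b = 2"
    then show ?thesis using b by simp
  next
    assume "form a b = - 2"
    then have "2 *\<^sub>R b = 2 *\<^sub>R (- a)" using b by simp
    then show ?thesis by (simp only: scaleR_cancel_left) simp
  qed
qed

lemma ext_reflection_root:
  assumes t: "t \<in> ext_reflections z"
  obtains a k where "a \<in> roots" "affine_map t = affine_refl a k" "rep (fst t) = refl a"
proof -
  obtain g x where gx: "g \<in> carrier \<G>" "x \<in> extended_gens s z" "t = g \<otimes>\<^bsub>\<G>\<^esub> x \<otimes>\<^bsub>\<G>\<^esub> inv\<^bsub>\<G>\<^esub> g"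
    using t by (auto simp: ext_reflections_eq)
  obtain i k where "x = translated_refl i k" using gx(2) by (rule extended_gens_translated_refl)
  then obtain k' where k': "affine_map t = affine_refl (rep (fst g) (\<alpha> i)) k'"
    using conj_affine_refl[OF gx(1)] gx(3) by metis
  have "fst g \<in> carrier W" using gx(1) by (auto simp: ext_group_simps)
  then have "rep (fst g) (\<alpha> i) \<in> roots"
    by (elim carrier_word_prod) (simp add: word_map_in_roots simple_root_in_roots)
  moreover have "t \<in> carrier \<G>" using t conjugation_closed.T_carrier[OF conjugation_closed_ext] by blast
  ultimately show thesis using that k' affine_refl_linear_part by blast
qed

text \<open>The linear part fixes the root only up to sign, and the sign can be absorbed into the
  level. This permits prescribing \<open>b\<close>.\<close>

lemma ext_reflection_affine:
  assumes t: "t \<in> ext_reflections z" and b: "b \<in> roots" "rep (fst t) = refl b"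
  obtains k where "affine_map t = affine_refl b k"
proof -
  obtain a k where a: "a \<in> roots" "affine_map t = affine_refl a k" "rep (fst t) = refl a"
    using t by (rule ext_reflection_root)
  then have "a = b \<or> a = - b"
    using refl_eq_iff b by metis
  moreover have "affine_refl (- b) k = affine_refl b (- k)"
    by (simp add: fun_eq_iff affine_refl_def reflect_uminus)
  ultimately show thesis using that a(2) by metis
qed

lemma ext_reflection_linear_part: "t \<in> ext_reflections z \<Longrightarrow> rep (fst t) \<in> linear_reflections"
  using ext_reflection_root refl_in_linear_reflections by metis

lemma linear_part_hom: "group_hom \<G> linear_group (\<lambda>g. rep (fst g))"
proof -
  interpret G: group \<G> by (rule group_ext_group)
  show ?thesis
    by (unfold_locales, rule homI) (auto simp: ext_group_simps rep_in_range rep_mult fun_eq_iff)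
qed

lemma affine_map_group_prod_nth:
  assumes "set xs \<subseteq> ext_reflections z" "map (\<lambda>t. rep (fst t)) xs = map (simple_reflection E) u" "j \<notin> set u"
  shows "affine_map (group_prod \<G> xs) x $ j = x $ j"
  using assms
proof (induction xs arbitrary: u)
  case Nil
  then show ?case by (simp add: affine_map_def ext_group_simps rep_one)
next
  case (Cons t xs)
  interpret G: conjugation_closed \<G> "ext_reflections z" by (rule conjugation_closed_ext)
  obtain i v where u: "u = i # v" using Cons.prems(2) by auto
  obtain k where k: "affine_map t = affine_refl (\<alpha> i) k"
    using ext_reflection_affine[of t z "\<alpha> i"] Cons.prems u
    by (auto simp: simple_root_in_roots simple_reflection_eq_reflect)
  have car: "t \<in> carrier \<G>" "set xs \<subseteq> carrier \<G>" using Cons.prems(1) G.T_carrier by auto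
  have "i \<noteq> j" using Cons.prems(3) u by auto
  then have "affine_map (group_prod \<G> (t # xs)) x $ j = affine_map (group_prod \<G> xs) x $ j"
    using car
    by (simp add: affine_map_mult k affine_refl_def reflect_def simple_root_nth)
  also have "\<dots> = x $ j" using Cons u by simp
  finally show ?case .
qed

text \<open>The last factor moves the origin along its own simple root by its level. The earlier
  factors, belonging to other letters, cannot repair that coordinate, so the level is 0; induction
  handles the rest.\<close>

lemma eq_extended_gens_if_fixes_origin:
  assumes "set xs \<subseteq> ext_reflections z" "map (\<lambda>t. rep (fst t)) xs = map (simple_reflection E) u"
    "distinct u" "affine_map (group_prod \<G> xs) 0 = 0"
  shows "xs = map (extended_gen s) u"
  using assms
proof (induction xs arbitrary: u rule: rev_induct)
  case (snoc t xs)
  interpret G: conjugation_closed \<G> "ext_reflections z" by (rule conjugation_closed_ext)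
  obtain i v where u: "u = v @ [i]" "map (\<lambda>t. rep (fst t)) xs = map (simple_reflection E) v"
    "rep (fst t) = simple_reflection E i"
    using snoc.prems(2) by (cases u rule: rev_cases) auto
  obtain k where k: "affine_map t = affine_refl (\<alpha> i) k"
    using ext_reflection_affine[of t z "\<alpha> i"] snoc.prems(1) u(3)
    by (auto simp: simple_root_in_roots simple_reflection_eq_reflect)
  have car: "t \<in> carrier \<G>" "set xs \<subseteq> carrier \<G>" using snoc.prems(1) G.T_carrier by auto
  have "affine_map t 0 = - of_int k *\<^sub>R \<alpha> i"
    by (simp add: k affine_refl_def reflect_def root_form_simps)
  then have prod: "affine_map (group_prod \<G> xs) (- of_int k *\<^sub>R \<alpha> i) = 0"
    using snoc.prems(4) car by (simp add: G.group_prod_append affine_map_mult)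
  have "affine_map (group_prod \<G> xs) (- of_int k *\<^sub>R \<alpha> i) $ i = - of_int k"
    using affine_map_group_prod_nth[of xs z v i] snoc.prems(1,3) u by (simp add: simple_root_nth)
  then have "k = 0" using prod by simp
  then have "affine_map t = affine_map (extended_gen s i)"
    using k by (simp add: translated_refl_eqs affine_map_translated_refl)
  then have "t = extended_gen s i"
    using car by (intro affine_map_inj) (simp_all add: translated_refl_eqs)
  moreover have "xs = map (extended_gen s) v"
    using snoc.IH[of v] snoc.prems(1,3) u prod \<open>k = 0\<close> by simp
  ultimately show ?case using u by simp
qed simp

lemma translated_refl_conj:
  "inv\<^bsub>\<G>\<^esub> (translated_refl i k) = translated_refl i k"
  "translated_refl i (k + 1) \<otimes>\<^bsub>\<G>\<^esub> translated_refl i k \<otimes>\<^bsub>\<G>\<^esub> translated_refl i (k + 1) = translated_refl i (k + 2)"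
  "translated_refl i k \<otimes>\<^bsub>\<G>\<^esub> translated_refl i (k + 1) \<otimes>\<^bsub>\<G>\<^esub> translated_refl i k = translated_refl i (k - 1)"
proof -
  interpret G: group \<G> by (rule group_ext_group)
  have inv_s: "inv (s i) = s i" by (rule inv_equality) (simp_all add: s_square)
  note simps = ext_group_simps translated_refl_def inv_s s_square simple_reflection_simple
    simple_reflection_eq_reflect reflect_simps reflect_self
  have "translated_refl i k \<otimes>\<^bsub>\<G>\<^esub> translated_refl i k = \<one>\<^bsub>\<G>\<^esub>" by (simp add: simps)
  then show "inv\<^bsub>\<G>\<^esub> (translated_refl i k) = translated_refl i k" by (rule G.inv_equality) simp_all
  show "translated_refl i (k + 1) \<otimes>\<^bsub>\<G>\<^esub> translated_refl i k \<otimes>\<^bsub>\<G>\<^esub> translated_refl i (k + 1) = translated_refl i (k + 2)"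
    "translated_refl i k \<otimes>\<^bsub>\<G>\<^esub> translated_refl i (k + 1) \<otimes>\<^bsub>\<G>\<^esub> translated_refl i k = translated_refl i (k - 1)"
    by (simp_all add: simps scaleR_add_left scaleR_diff_left scaleR_2)
qed

text \<open>Reflecting a level in an adjacent one is an infinite dihedral computation: a single
  Hurwitz move raises or lowers both levels by 1.\<close>

lemma equiv_shift_pair:
  "hurwitz_equiv \<G> (xs @ [translated_refl i k, translated_refl i (k + 1)]) (xs @ [translated_refl i 0, translated_refl i 1])"
proof (induction k rule: int_induct[where k = 0])
  case base
  then show ?case by (simp add: hurwitz_equiv_refl)
next
  case (step1 k)
  have "hurwitz_equiv \<G> (xs @ [translated_refl i (k + 1), translated_refl i (k + 1 + 1)])
    (xs @ [translated_refl i k, translated_refl i (k + 1)])"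
    using hurwitz_equiv_left[of \<G> xs "translated_refl i (k + 1)" "translated_refl i (k + 1 + 1)" "[]"]
      translated_refl_conj(3)[of i "k + 1"] translated_refl_conj(1)[of i "k + 1"] by simp
  then show ?case using step1 hurwitz_equiv_trans by blast
next
  case (step2 k)
  have "hurwitz_equiv \<G> (xs @ [translated_refl i (k - 1), translated_refl i k])
    (xs @ [translated_refl i k, translated_refl i (k + 1)])"
    using hurwitz_equiv_right[of \<G> xs "translated_refl i (k - 1)" "translated_refl i k" "[]"]
      translated_refl_conj(2)[of i "k - 1"] translated_refl_conj(1)[of i k] by (simp add: add.commute)
  then show ?case using step2 hurwitz_equiv_trans by simp blast
qed

section \<open>Recovering a factorization from its linear parts\<close>

context
  fixes z u c ts
  assumes u: "distinct u" "set u = UNIV - {z}"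
    and c: "c = group_prod \<G> (map (extended_gen s) u) \<otimes>\<^bsub>\<G>\<^esub> extended_gen s z \<otimes>\<^bsub>\<G>\<^esub> extra_gen s z"
    and ts: "ts \<in> factorizations \<G> (ext_reflections z) (CARD('n) + 1) c"
begin

interpretation G: conjugation_closed \<G> "ext_reflections z" by (rule conjugation_closed_ext)

abbreviation linear_part :: "'w \<times> (real ^ 'n) \<Rightarrow> real ^ 'n \<Rightarrow> real ^ 'n" where
  "linear_part t \<equiv> rep (fst t)"

lemma affine_map_extended_gens: "affine_map (group_prod \<G> (map (extended_gen s) v)) x = word_map v x"
proof (induction v)
  case Nil
  then show ?case by (simp add: affine_map_def ext_group_simps rep_one)
next
  case (Cons i v)
  then show ?case by (simp add: affine_map_mult affine_map_extended_gen)
qed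

lemma affine_map_c: "affine_map c x = word_map u (x + \<alpha> z)"
proof -
  have "affine_map c x = word_map u (simple_reflection E z (affine_refl (\<alpha> z) 1 x))"
    unfolding c by (simp add: affine_map_mult affine_map_extended_gens affine_map_extended_gen affine_map_extra_gen)
  also have "simple_reflection E z (affine_refl (\<alpha> z) 1 x) = x + \<alpha> z"
    by (simp add: affine_refl_def simple_reflection_eq_reflect reflect_simps reflect_reflect reflect_self)
  finally show ?thesis .
qed

lemma c_closed: "c \<in> carrier \<G>"
  by (simp add: c)

lemma linear_part_c: "linear_part c = word_map u"
  using rep_eq_affine_map[OF c_closed] by (simp add: fun_eq_iff affine_map_c word_map_simps linear_0[OF word_map_linear])

text \<open>The last two factors compose to a translation by \<open>l - k\<close> times
  \<open>b\<close>. Needed twice: for the unknown \<open>b\<close>, to find its coefficient at z,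
  and for \<open>\<alpha> z\<close>, to determine the translation parts.\<close>

lemma lift_to_pair:
  assumes b: "b \<in> roots"
    and equiv: "hurwitz_equiv linear_group (map linear_part ts) (map (simple_reflection E) u @ [refl b, refl b])"
  obtains xs p q k l where "hurwitz_equiv \<G> ts (xs @ [p, q])"
    "set (xs @ [p, q]) \<subseteq> ext_reflections z" "map linear_part xs = map (simple_reflection E) u"
    "affine_map p = affine_refl b k" "affine_map q = affine_refl b l" "of_int (l - k) * b $ z = 1"
    "\<And>x. affine_map (group_prod \<G> xs) (x + of_int (l - k) *\<^sub>R b) = word_map u (x + \<alpha> z)"
proof -
  have "set ts \<subseteq> carrier \<G>" using ts G.T_carrier by (auto simp: factorizations_def)
  then obtain vs where vs: "hurwitz_equiv \<G> ts vs"
    "map linear_part vs = map (simple_reflection E) u @ [refl b, refl b]"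
    using hurwitz_equiv_lift[OF linear_part_hom _ equiv] by blast
  then have "vs \<in> factorizations \<G> (ext_reflections z) (CARD('n) + 1) c"
    using G.hurwitz_equiv_factorizations ts by blast
  then have fac: "set vs \<subseteq> ext_reflections z" "group_prod \<G> vs = c" by (auto simp: factorizations_def)
  obtain xs ys where split: "vs = xs @ ys" "map linear_part xs = map (simple_reflection E) u"
    "map linear_part ys = [refl b, refl b]"
    using vs(2) by (auto simp: map_eq_append_conv)
  then obtain p q where pq: "ys = [p, q]" "linear_part p = refl b" "linear_part q = refl b" by auto
  obtain k where k: "affine_map p = affine_refl b k"
    using ext_reflection_affine[of p z b] fac split pq b by auto
  obtain l where l: "affine_map q = affine_refl b l"
    using ext_reflection_affine[of q z b] fac split pq b by auto
  have car: "set xs \<subseteq> carrier \<G>" "p \<in> carrier \<G>" "q \<in> carrier \<G>"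
    using fac split pq G.T_carrier by auto
  have pair: "affine_refl b k (affine_refl b l x) = x + of_int (l - k) *\<^sub>R b" for x
    using b by (simp add: affine_refl_def reflect_simps reflect_reflect reflect_self algebra_simps)
  have "group_prod \<G> (xs @ [p, q]) = c" using fac split pq by simp
  then have "affine_map (group_prod \<G> xs) (affine_map p (affine_map q x)) = affine_map c x" for x
    using car by (simp add: G.group_prod_append flip: affine_map_mult)
  then have prod: "affine_map (group_prod \<G> xs) (x + of_int (l - k) *\<^sub>R b) = word_map u (x + \<alpha> z)" for x
    by (simp only: k l pair affine_map_c)
  \<comment> \<open>Coordinate z at x = 0: no letter of u changes it, neither through
    \<open>xs\<close> on the left nor through \<open>word_map u\<close> on the right.\<close>
  have "z \<notin> set u" using u by simp
  then have "of_int (l - k) * b $ z = (1 :: real)"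
    using arg_cong[OF prod[of 0], of "\<lambda>v. v $ z"] affine_map_group_prod_nth[of xs z u z] fac split
    by (simp add: word_map_nth simple_root_nth)
  then show thesis
    using that[OF _ _ split(2) k l _ prod] vs(1) fac(1) split pq by simp
qed

lemma equiv_standard_factorization:
  "hurwitz_equiv \<G> ts (map (extended_gen s) u @ [extended_gen s z, extra_gen s z])"
proof -
  interpret h: group_hom \<G> linear_group linear_part by (rule linear_part_hom)
  let ?rs = "map linear_part ts"
  have T: "set ts \<subseteq> ext_reflections z" "group_prod \<G> ts = c" "length ts = CARD('n) + 1"
    using ts by (auto simp: factorizations_def)
  have rs: "set ?rs \<subseteq> linear_reflections"
    using T(1) ext_reflection_linear_part by auto
  have "linear_part (group_prod \<G> vs) = group_prod linear_group (map linear_part vs)"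
    if "set vs \<subseteq> carrier \<G>" for vs
    using that
  proof (induction vs)
    case Nil
    then show ?case using h.hom_one by simp
  next
    case (Cons t vs)
    then show ?case using h.hom_mult[of t "group_prod \<G> vs"] by simp
  qed
  then have prod: "group_prod linear_group ?rs = word_map u"
    using T G.T_carrier linear_part_c by (metis subset_trans)
  have "length u = CARD('n) - 1"
    using distinct_card[OF u(1)] u(2) by (simp add: card_Diff_singleton)
  then have len: "length ?rs = length u + 2"
    using T(3) zero_less_card_finite[where 'a = 'n] by simp
  obtain b where b: "b \<in> roots"
    "hurwitz_equiv linear_group ?rs (map (simple_reflection E) u @ [refl b, refl b])"
    using equiv_simple_word_pair[OF rs prod u(1) len] by blast
  obtain m :: int where m: "b $ z = of_int m"
    using integral_root[OF b(1)] by (auto simp: integral_vec_def elim: Ints_cases)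
  obtain k l :: int where "of_int (l - k) * b $ z = 1"
    by (rule lift_to_pair[OF b]) (rule that)
  then have "(l - k) * m = 1" unfolding m by (metis of_int_1 of_int_eq_iff of_int_mult)
  then have "m = 1 \<or> m = - 1" using zmult_eq_1_iff by blast
  \<comment> \<open>A coefficient -1 is harmless because \<open>b\<close> and its negative define
    the same reflection.\<close>
  then have "b $ z = 1 \<or> (- b) $ z = 1" using m by auto
  then obtain b' where b': "b' \<in> roots" "b' $ z = 1" "refl b' = refl b"
    using b(1) uminus_in_roots[OF b(1)] reflect_uminus[of E b] by blast
  have equiv: "hurwitz_equiv linear_group ?rs (map (simple_reflection E) u @ [refl (\<alpha> z), refl (\<alpha> z)])"
    using hurwitz_equiv_trans[OF b(2)] equiv_simple_pair[OF b'(1,2), of u] b'(3) u(2) by simp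
  obtain xs p q k l where lift: "hurwitz_equiv \<G> ts (xs @ [p, q])"
    "set (xs @ [p, q]) \<subseteq> ext_reflections z" "map linear_part xs = map (simple_reflection E) u"
    "affine_map p = affine_refl (\<alpha> z) k" "affine_map q = affine_refl (\<alpha> z) l"
    "of_int (l - k) * \<alpha> z $ z = 1"
    "\<And>x. affine_map (group_prod \<G> xs) (x + of_int (l - k) *\<^sub>R \<alpha> z) = word_map u (x + \<alpha> z)"
    by (rule lift_to_pair[OF simple_root_in_roots equiv]) (rule that)
  have "of_int (l - k) = (1 :: real)" using lift(6) by (simp add: simple_root_nth)
  then have l: "l = k + 1" by linarith
  \<comment> \<open>As the difference of the levels is 1, the choice x = \<open>- \<alpha> z\<close>
    makes both arguments the origin.\<close>
  then have "affine_map (group_prod \<G> xs) 0 = 0"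
    using lift(7)[of "- \<alpha> z"] by (simp add: linear_0[OF word_map_linear])
  then have xs: "xs = map (extended_gen s) u"
    using eq_extended_gens_if_fixes_origin[of xs z u] lift(2,3) u(1) by simp
  have "p = translated_refl z k" "q = translated_refl z (k + 1)"
    using lift(2,4,5) l G.T_carrier by (auto intro!: affine_map_inj simp: affine_map_translated_refl)
  then show ?thesis
    using hurwitz_equiv_trans[OF lift(1)] equiv_shift_pair[of xs z k] xs by (simp add: translated_refl_eqs)
qed

end

end

theorem theorem8p6:
  fixes W :: "('w, 'b) monoid_scheme"
    and s :: "'n::finite \<Rightarrow> 'w"
    and E :: "'n \<Rightarrow> 'n \<Rightarrow> bool"
    and z :: 'n
    and c :: "'w \<times> (real ^ 'n)"
  assumes "star_graph E"
    and "coxeter_system W s (simply_laced_matrix E)"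
    and "admissible_centre E z"
    and "coxeter_transformation W s E z c"
  shows "transitive_action (braid_group (CARD('n) + 1)) (red_factorizations W s E z c)
    (hurwitz_action (extended_group W s E) (red_factorizations W s E z c))"
proof -
  interpret coxeter_geometry E W s
    using assms(1,2) by (intro coxeter_geometry_if_coxeter_system) (auto simp: star_graph_def tree_graph_def)
  interpret G: conjugation_closed "extended_group W s E" "reflections W s E z"
    by (rule conjugation_closed_ext)
  obtain u where u: "distinct u" "set u = UNIV - {z}"
    and c: "c = group_prod (extended_group W s E) (map (extended_gen s) u)
      \<otimes>\<^bsub>extended_group W s E\<^esub> extended_gen s z \<otimes>\<^bsub>extended_group W s E\<^esub> extra_gen s z"
    using assms(4) by (auto simp: coxeter_transformation_def Let_def)
  show ?thesis
    unfolding red_factorizations_def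
    using equiv_standard_factorization[OF u c] by (rule G.hurwitz_transitive_action)
qed

end
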